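(* Let $s \geq 3$ be an integer and let $G$ be a finite group with a $(2,s,3)$-presentation, that is, $G$ is generated by two elements $a$ and $b$ such that $a$ has order $2$, $b$ has order $s$, and the product $ab$ has order $3$. Let $X = \mathrm{Cay}(G,\{a,b,b^{-1}\})$ be the corresponding (cubic) Cayley graph. Then: (1) if $|G| \equiv 2 \pmod 4$ (and thus also $s \equiv 2 \pmod 4$), then $X$ has a Hamilton cycle; (2) if $|G| \equiv 0 \pmod 4$, then $X$ has a cycle of length $|G|-2$, and thus necessarily a Hamilton path.
   Context: The presentation is written $G=\langle a,b \mid a^2=1,\ b^s=1,\ (ab)^3=1,\ \text{etc.}\rangle$, where "etc." means that additional relations may hold in $G$; the orders of $a$, $b$, $ab$ are exactly $2$, $s$, $3$ respectively. The Cayley graph $\mathrm{Cay}(G,\{a,b,b^{-1}\})$ is the simple undirected graph with vertex set $G$ in which $g$ is adjacent to $ga$, $gb$ and $gb^{-1}$ for every $g\in G$. A Hamilton cycle (respectively Hamilton path) is a simple cycle (respectively simple path) passing through all vertices of the graph. A cycle of length $\ell$ is a simple cycle on $\ell$ vertices. *)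

theory Defs
  imports
    "HOL-Algebra.Generated_Groups"
    "HOL-Algebra.Multiplicative_Group"
    "Graph_Theory.Pair_Digraph"
begin

text \<open>
  As usual in Graph_Theory, a simple undirected graph is a symmetric loop-free digraph without
  parallel arcs, i.e. an instance of \<^locale>\<open>pair_graph\<close>. For the connection sets
  considered here this is established in \<open>pair_graph_cayley_graph\<close> below.
\<close>

definition cayley_graph :: "('a, 'm) monoid_scheme \<Rightarrow> 'a set \<Rightarrow> 'a pair_pre_digraph" where
  "cayley_graph G S =
     \<lparr> pverts = carrier G,
       parcs = {(g, g \<otimes>\<^bsub>G\<^esub> x) | g x. g \<in> carrier G \<and> x \<in> S} \<rparr>"

text \<open>
  The library's \<^const>\<open>pre_digraph.cycle\<close> is a closed walk, given as its list of arcs,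
  that repeats no vertex besides its endpoint. In a symmetric digraph it includes the walks
  $u, v, u$ of length 2, which are not cycles of the undirected graph; the bound on the length
  excludes them. The number of vertices on such a cycle is its number of arcs.
\<close>

definition ugraph_cycle :: "('a, 'b) pre_digraph \<Rightarrow> 'b awalk \<Rightarrow> bool" where
  "ugraph_cycle X p \<longleftrightarrow> pre_digraph.cycle X p \<and> length p \<ge> 3"

definition hamilton_cycle :: "('a, 'b) pre_digraph \<Rightarrow> 'b awalk \<Rightarrow> bool" where
  "hamilton_cycle X p \<longleftrightarrow> ugraph_cycle X p \<and> tail X ` set p = verts X"

definition hamilton_path :: "('a, 'b) pre_digraph \<Rightarrow> 'a \<Rightarrow> 'b awalk \<Rightarrow> 'a \<Rightarrow> bool" where
  "hamilton_path X u p v \<longleftrightarrow>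
     pre_digraph.apath X u p v \<and> set (pre_digraph.awalk_verts X u p) = verts X"

lemma pair_graph_cayley_graph:
  fixes G (structure)
  assumes "group G" "finite (carrier G)"
    and S: "S \<subseteq> carrier G" "\<one> \<notin> S" "\<And>x. x \<in> S \<Longrightarrow> inv x \<in> S"
  shows "pair_graph (cayley_graph G S)"
proof -
  interpret group G by fact
  have arcs: "parcs (cayley_graph G S) \<subseteq> carrier G \<times> carrier G"
    using S by (auto simp: cayley_graph_def)
  have sym: "(g \<otimes> x, g) \<in> parcs (cayley_graph G S)" if "g \<in> carrier G" "x \<in> S" for g x
  proof -
    have x: "x \<in> carrier G" using that S by auto
    then have "g = (g \<otimes> x) \<otimes> inv x" using that by (simp add: m_assoc)
    moreover have "g \<otimes> x \<in> carrier G" using that x by simp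
    ultimately show ?thesis
      using S(3)[OF that(2)] by (simp add: cayley_graph_def) blast
  qed
  show ?thesis
  proof
    show "finite (parcs (cayley_graph G S))"
      using arcs assms(2) by (meson finite_SigmaI finite_subset)
    show "symmetric (with_proj (cayley_graph G S))"
      unfolding symmetric_def
      by (rule symI) (use sym in \<open>auto simp: cayley_graph_def\<close>)
    show "fst e \<noteq> snd e" if "e \<in> parcs (cayley_graph G S)" for e
    proof -
      from that have "\<exists>g x. e = (g, g \<otimes> x) \<and> g \<in> carrier G \<and> x \<in> S"
        unfolding cayley_graph_def by simp
      then obtain g x where e: "e = (g, g \<otimes> x)" "g \<in> carrier G" "x \<in> S"
        by blast
      have "x \<in> carrier G" "x \<noteq> \<one>" using e S by auto
      then show ?thesis using e by simp
    qed
  qed (use S(1) assms(2) in \<open>auto simp: cayley_graph_def\<close>)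
qed

lemma
  fixes G (structure)
  assumes "group G" "finite (carrier G)"
    and ab: "a \<in> carrier G" "b \<in> carrier G"
    and ord: "group.ord G a = 2" "group.ord G b = s" "s \<ge> 3"
  shows pair_graph_cayley_graph_gens: "pair_graph (cayley_graph G {a, b, inv b})"
    and cayley_graph_gens_cubic:
      "g \<in> carrier G \<Longrightarrow> out_degree (with_proj (cayley_graph G {a, b, inv b})) g = 3"
proof -
  interpret group G by fact
  have a: "a \<noteq> \<one>" "inv a = a"
  proof -
    show "a \<noteq> \<one>" using ord ord_id by auto
    have "a [^] (2::nat) = \<one>" using ab ord pow_ord_eq_1 by metis
    then have "a \<otimes> a = \<one>" using ab by (simp add: numeral_2_eq_2)
    then show "inv a = a" using ab inv_equality by blast
  qed
  have b: "b \<noteq> \<one>" "\<one> \<noteq> inv b" "b \<noteq> inv b"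
  proof -
    show "b \<noteq> \<one>" using ord ord_id by auto
    then show "\<one> \<noteq> inv b" using ab inv_eq_1_iff by metis
    show "b \<noteq> inv b"
    proof
      assume "b = inv b"
      then have "b \<otimes> b = \<one>" using ab r_inv by metis
      then have "b [^] (2::nat) = \<one>" using ab by (simp add: numeral_2_eq_2)
      then have "ord b dvd 2" using ab pow_eq_id by blast
      then show False using ord by (auto dest: dvd_imp_le)
    qed
  qed
  have "a \<noteq> b" using ord by auto
  moreover have "a \<noteq> inv b" using \<open>a \<noteq> b\<close> a ab inv_inv by metis
  ultimately have card: "card {a, b, inv b} = 3" using b by auto
  show "pair_graph (cayley_graph G {a, b, inv b})"
    by (rule pair_graph_cayley_graph) (use assms a b in auto)
  assume g: "g \<in> carrier G"
  have "out_arcs (with_proj (cayley_graph G {a, b, inv b})) g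
      = (\<lambda>x. (g, g \<otimes> x)) ` {a, b, inv b}"
    unfolding out_arcs_def using g by (auto simp: cayley_graph_def)
  moreover have "inj_on (\<lambda>x. (g, g \<otimes> x)) {a, b, inv b}"
    using g ab by (auto simp: inj_on_def)
  ultimately show "out_degree (with_proj (cayley_graph G {a, b, inv b})) g = 3"
    unfolding out_degree_def using card by (simp only: card_image)
qed

end

theory Submission
  imports
    Defs
    "HOL-Library.Disjoint_Sets"
    "HOL-Combinatorics.Permutations"
begin

text \<open>
  The relation $(ab)^3 = 1$ gives hexagons in the Cayley graph. They are the vertices of a
  connected cubic graph \<open>H\<close> of order $m = |G| / 3$, two hexagons being adjacent when they share an edge of
  type \<open>a\<close>, and \<open>G\<close> acts transitively on the darts of \<open>H\<close>. If \<open>k\<close> hexagons induce a tree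
  in \<open>H\<close>, their union is a disc bounded by a cycle of length $4 k + 2$. So an induced
  tree on $(3 m - 2) / 4$ vertices (for $m \<equiv> 2$ mod 4) or $(3 m - 4) / 4$ vertices (for $m \<equiv> 0$ mod 4) is
  needed.

  By a submodularity argument dart-transitivity forces every edge cut of \<open>H\<close> to have at least three
  edges, with equality only around a single vertex. Hence \<open>H\<close>, respectively \<open>H\<close> minus two adjacent
  vertices, satisfies Nebesky's criterion for a spanning tree whose cotree splits into pairs of adjacent
  edges. Deleting the common vertices of these pairs leaves an induced tree of the required size.
\<close>

subsection \<open>Nebesky's criterion\<close>

text \<open>Two hexagons joined by a tree edge share two vertices, so \<open>k\<close> of them have
  $6k - 2(k-1) = 4k + 2$ vertices; equating this with $|G| = 3m$ or $|G| - 2$ gives the two tree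
  sizes.

  Why pairs of adjacent edges: let \<open>J\<close> consist of one common vertex for each pair of
  cotree edges, so that $2|J|$ is at most the cycle rank. Deleting \<open>J\<close> leaves only tree
  edges, yet destroys at most $3|J|$ edges. This leaves $|V| - |J| - 1$ edges or more, so the
  remaining forest is connected.

  Obstacle: the pairing needs an even cycle rank, and that of the hexagon graph is $m/2 + 1$. Two
  adjacent vertices take 5 edges with them, so deleting them lowers the rank by 3 and makes it even.
  The price is the two elements of \<open>G\<close> that the cycle misses.

  Why cuts: the crossing edges of a partition number half the sum of the block boundaries. So it
  suffices that a block has boundary at least 2, and at least 4 if its cycle rank is odd. Only the
  value 3 is critical, and a single vertex, whose rank is 0, does no harm there.\<close>

definition induced :: "('e \<Rightarrow> 'v set) \<Rightarrow> 'e set \<Rightarrow> 'v set \<Rightarrow> 'e set" where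
  "induced ends F X = {e \<in> F. ends e \<subseteq> X}"

text \<open>A set of $|V| - 1$ edges is sparse on \<open>V\<close> iff it is the edge set of a spanning tree;
  this counting form makes connectedness and acyclicity unnecessary.\<close>

definition sparse :: "('e \<Rightarrow> 'v set) \<Rightarrow> 'e set \<Rightarrow> 'v set \<Rightarrow> bool" where
  "sparse ends F V \<longleftrightarrow> (\<forall>Z \<subseteq> V. Z \<noteq> {} \<longrightarrow> card (induced ends F Z) < card Z)"

text \<open>A connected block is counted here iff its cycle rank $e(X) - |X| + 1$ is odd.\<close>

definition odd_blocks :: "('e \<Rightarrow> 'v set) \<Rightarrow> 'e set \<Rightarrow> 'v set set \<Rightarrow> 'v set set" where
  "odd_blocks ends F P = {X \<in> P. even (card (induced ends F X) + card X)}"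

definition cross :: "('e \<Rightarrow> 'v set) \<Rightarrow> 'e set \<Rightarrow> 'v set set \<Rightarrow> 'e set" where
  "cross ends F P = {e \<in> F. \<forall>X \<in> P. \<not> ends e \<subseteq> X}"

text \<open>Nebesky's criterion for upper embeddability asks for $c(F - A) + b(F - A) \<le> |A| + 1$ for all edge
  sets \<open>A\<close>, where \<open>b\<close> counts the components of odd cycle rank. Moving an edge inside a block
  into \<open>A\<close> flips the parity of that block, so it suffices to consider the edges crossing a partition.\<close>

definition nebesky :: "('e \<Rightarrow> 'v set) \<Rightarrow> 'e set \<Rightarrow> 'v set \<Rightarrow> bool" where
  "nebesky ends F V \<longleftrightarrow>
     (\<forall>P. partition_on V P \<longrightarrow> card P + card (odd_blocks ends F P) \<le> card (cross ends F P) + 1)"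

lemma induced_subset: "induced ends F X \<subseteq> F"
  by (auto simp: induced_def)

lemma finite_induced: "finite F \<Longrightarrow> finite (induced ends F X)"
  by (auto simp: induced_def)

lemma sparse_mono:
  assumes "finite F" "F' \<subseteq> F" "sparse ends F V"
  shows "sparse ends F' V"
  unfolding sparse_def
proof (intro allI impI)
  fix Z assume Z: "Z \<subseteq> V" "Z \<noteq> {}"
  have "card (induced ends F' Z) \<le> card (induced ends F Z)"
    using assms by (intro card_mono) (auto simp: induced_def)
  then show "card (induced ends F' Z) < card Z"
    using assms(3) Z by (auto simp: sparse_def intro: le_less_trans)
qed

text \<open>The defect counts the edges inside \<open>X \<union> Y\<close> that meet both
  \<open>X - Y\<close> and \<open>Y - X\<close>. This makes tight sets intersect in a tight
  set.\<close>

lemma induced_supermodular: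
  assumes "finite F"
  shows "card (induced ends F X) + card (induced ends F Y)
       \<le> card (induced ends F (X \<union> Y)) + card (induced ends F (X \<inter> Y))"
proof -
  have "card (induced ends F X) + card (induced ends F Y)
      = card (induced ends F X \<union> induced ends F Y) + card (induced ends F X \<inter> induced ends F Y)"
    using assms by (intro card_Un_Int finite_induced)
  also have "induced ends F X \<inter> induced ends F Y = induced ends F (X \<inter> Y)"
    by (auto simp: induced_def)
  also have "card (induced ends F X \<union> induced ends F Y) \<le> card (induced ends F (X \<union> Y))"
    using assms by (intro card_mono finite_induced) (auto simp: induced_def)
  finally show ?thesis by simp
qed

text \<open>Tight sets containing a fixed node are closed under intersection, so an edge at that node inside
  the smallest tight set can be assigned to it and deleted.\<close>

lemma sparse_transversal:
  assumes "finite Q" "finite D" "U \<subseteq> Q"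
    and "\<And>e. e \<in> D \<Longrightarrow> ends e \<subseteq> Q \<and> card (ends e) = 2"
    and "\<And>Z. Z \<subseteq> Q \<Longrightarrow> Z \<noteq> {} \<Longrightarrow> card (induced ends D Z) + 1 \<le> card Z + card (Z \<inter> U)"
    and "card D + 1 = card Q + card U"
  shows "\<exists>h. (\<forall>K\<in>U. h K \<in> D \<and> K \<in> ends (h K)) \<and> sparse ends (D - h ` U) Q"
proof -
  have "finite U" using assms finite_subset by blast
  then show ?thesis using assms(2-)
  proof (induction U arbitrary: D rule: finite_induct)
    case empty
    then have "sparse ends D Q" by (simp add: sparse_def Suc_le_eq)
    then show ?case by simp
  next
    case (insert K U)
    note fD = insert.prems(1) and ends = insert.prems(3) and cnt = insert.prems(4)
    have finZ: "finite Z" if "Z \<subseteq> Q" for Z using that assms(1) finite_subset by blast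
    \<comment> \<open>The sets through \<open>K\<close> for which \<open>cnt\<close> holds with
      equality: exactly those that would break if \<open>K\<close> left \<open>U\<close> and no edge
      were deleted.\<close>
    define Ti where "Ti Z \<longleftrightarrow> Z \<subseteq> Q \<and> K \<in> Z \<and>
      card (induced ends D Z) + 1 = card Z + card (Z \<inter> insert K U)" for Z
    have indQ: "induced ends D Q = D" using ends by (auto simp: induced_def)
    have KQ: "K \<in> Q" "U \<subseteq> Q" using insert.prems(2) by auto
    have "Ti Q" using insert.prems(5) insert.hyps indQ KQ assms(1) 
      by (auto simp: Ti_def Int_absorb1)
    then obtain Z0 where Z0: "Ti Z0" and minZ: "\<And>Z. Ti Z \<Longrightarrow> card Z0 \<le> card Z"
      using ex_has_least_nat[of Ti Q card] by blast
    have Z0sub: "Z0 \<subseteq> Z" if "Ti Z" for Z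
    proof -
      have sub: "Z \<subseteq> Q" "Z0 \<subseteq> Q" "K \<in> Z" "K \<in> Z0" using that Z0 by (auto simp: Ti_def)
      have f: "finite Z" "finite Z0" using finZ sub by auto
      have 1: "card (induced ends D Z) + card (induced ends D Z0)
         \<le> card (induced ends D (Z \<union> Z0)) + card (induced ends D (Z \<inter> Z0))"
        by (rule induced_supermodular[OF fD])
      have 2: "card (induced ends D (Z \<union> Z0)) + 1 \<le> card (Z \<union> Z0) + card ((Z \<union> Z0) \<inter> insert K U)"
        by (rule cnt) (use sub in auto)
      have 3: "card (induced ends D (Z \<inter> Z0)) + 1 \<le> card (Z \<inter> Z0) + card ((Z \<inter> Z0) \<inter> insert K U)"
        by (rule cnt) (use sub in auto)
      have 4: "card Z + card Z0 = card (Z \<union> Z0) + card (Z \<inter> Z0)" by (rule card_Un_Int[OF f])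
      have "(Z \<union> Z0) \<inter> insert K U = (Z \<inter> insert K U) \<union> (Z0 \<inter> insert K U)"
           "(Z \<inter> Z0) \<inter> insert K U = (Z \<inter> insert K U) \<inter> (Z0 \<inter> insert K U)" by auto
      then have 5: "card (Z \<inter> insert K U) + card (Z0 \<inter> insert K U)
          = card ((Z \<union> Z0) \<inter> insert K U) + card ((Z \<inter> Z0) \<inter> insert K U)"
        using card_Un_Int[of "Z \<inter> insert K U" "Z0 \<inter> insert K U"] f by simp
      have "card (induced ends D (Z \<inter> Z0)) + 1 = card (Z \<inter> Z0) + card ((Z \<inter> Z0) \<inter> insert K U)"
        using 1 2 3 4 5 that Z0 unfolding Ti_def by linarith
      then have "Ti (Z \<inter> Z0)" using sub by (auto simp: Ti_def)
      then have "card Z0 \<le> card (Z \<inter> Z0)" by (rule minZ)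
      then have "Z \<inter> Z0 = Z0" using f by (intro card_seteq) auto
      then show ?thesis by auto
    qed
    have fZ0: "finite Z0" and KZ0: "K \<in> Z0" and subZ0: "Z0 \<subseteq> Q" using Z0 finZ by (auto simp: Ti_def)
    \<comment> \<open>Otherwise dropping \<open>K\<close> from \<open>Z0\<close> would lose a node
      but no edge, against \<open>cnt\<close>. If \<open>Z0\<close> is just \<open>{K}\<close>,
      tightness itself asks for one edge.\<close>
    have "\<exists>e \<in> induced ends D Z0. K \<in> ends e"
    proof (rule ccontr)
      assume neg: "\<not> ?thesis"
      then have eq: "induced ends D Z0 = induced ends D (Z0 - {K})" by (auto simp: induced_def)
      show False
      proof (cases "Z0 = {K}")
        case True
        have "induced ends D (Z0 - {K}) = {}" using True ends by (fastforce simp: induced_def)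
        then show False using Z0 True eq by (simp add: Ti_def)
      next
        case False
        then have "Z0 - {K} \<noteq> {}" using KZ0 by auto
        then have "card (induced ends D (Z0 - {K})) + 1 \<le> card (Z0 - {K}) + card ((Z0 - {K}) \<inter> insert K U)"
          by (intro cnt) (use subZ0 in auto)
        moreover have "card (Z0 - {K}) + 1 = card Z0" using fZ0 KZ0 by (metis Suc_eq_plus1 card_Suc_Diff1)
        moreover have "card ((Z0 - {K}) \<inter> insert K U) \<le> card (Z0 \<inter> insert K U)"
          using fZ0 by (intro card_mono) auto
        moreover have "card Z0 + card (Z0 \<inter> insert K U) = card (induced ends D Z0) + 1"
          using Z0 by (simp add: Ti_def)
        moreover have "card (induced ends D Z0) = card (induced ends D (Z0 - {K}))" using eq by simp
        ultimately show False by linarith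
      qed
    qed
    then obtain d where d: "d \<in> D" "ends d \<subseteq> Z0" "K \<in> ends d" by (auto simp: induced_def)
    have cD: "card (D - {d}) + 1 = card D" using d fD by (metis Suc_eq_plus1 card_Suc_Diff1)
    have "\<exists>h. (\<forall>K\<in>U. h K \<in> D - {d} \<and> K \<in> ends (h K)) \<and> sparse ends (D - {d} - h ` U) Q"
    proof (rule insert.IH)
      show "finite (D - {d})" "U \<subseteq> Q" using fD KQ by auto
      show "\<And>e. e \<in> D - {d} \<Longrightarrow> ends e \<subseteq> Q \<and> card (ends e) = 2" using ends by auto
      show "card (D - {d}) + 1 = card Q + card U" using insert.prems(5) insert.hyps cD by simp
      fix Z assume Z: "Z \<subseteq> Q" "Z \<noteq> {}"
      have c: "card (induced ends D Z) + 1 \<le> card Z + card (Z \<inter> insert K U)" by (rule cnt[OF Z])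
      have le: "card (induced ends (D - {d}) Z) \<le> card (induced ends D Z)"
        using fD by (intro card_mono finite_induced) (auto simp: induced_def)
      \<comment> \<open>A set through \<open>K\<close> loses one unit on the right. If it is tight,
        it contains \<open>Z0\<close> and loses the edge \<open>d\<close> on the left as well;
        otherwise it had a unit to spare.\<close>
      show "card (induced ends (D - {d}) Z) + 1 \<le> card Z + card (Z \<inter> U)"
      proof (cases "K \<in> Z")
        case False
        then have "Z \<inter> insert K U = Z \<inter> U" by auto
        then show ?thesis using c le by simp
      next
        case True
        then have "Z \<inter> insert K U = insert K (Z \<inter> U)" by auto
        then have ci: "card (Z \<inter> insert K U) = card (Z \<inter> U) + 1"
          using finZ[OF Z(1)] insert.hyps by simp
        show ?thesis
        proof (cases "Ti Z")
          case t: True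
          then have "ends d \<subseteq> Z" using Z0sub d by blast
          then have "induced ends (D - {d}) Z = induced ends D Z - {d}" "d \<in> induced ends D Z"
            using d by (auto simp: induced_def)
          then have "card (induced ends (D - {d}) Z) + 1 = card (induced ends D Z)"
            using finite_induced[OF fD] by (metis Suc_eq_plus1 card_Suc_Diff1)
          then show ?thesis using c ci by linarith
        next
          case False
          then have "card (induced ends D Z) + 1 < card Z + card (Z \<inter> insert K U)"
            using c Z True by (auto simp: Ti_def)
          then show ?thesis using le ci by linarith
        qed
      qed
    qed
    then obtain h where h: "\<forall>K\<in>U. h K \<in> D - {d} \<and> K \<in> ends (h K)"
      "sparse ends (D - {d} - h ` U) Q" by blast
    have "(h(K := d)) ` insert K U = insert d (h ` U)" using insert.hyps by auto
    then have "D - (h(K := d)) ` insert K U = D - {d} - h ` U" by auto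
    moreover have "\<forall>L\<in>insert K U. (h(K := d)) L \<in> D \<and> L \<in> ends ((h(K := d)) L)"
      using h d insert.hyps by auto
    ultimately show ?case using h(2) by metis
  qed
qed

section \<open>Edge counts and parity over partitions\<close>

definition multigraph :: "('e \<Rightarrow> 'v set) \<Rightarrow> 'e set \<Rightarrow> 'v set \<Rightarrow> bool" where
  "multigraph ends F V \<longleftrightarrow> finite V \<and> finite F \<and> (\<forall>e\<in>F. ends e \<subseteq> V \<and> card (ends e) = 2)"

lemma multigraph_nonempty: "multigraph ends F V \<Longrightarrow> e \<in> F \<Longrightarrow> ends e \<noteq> {}"
  by (auto simp: multigraph_def)

lemma multigraph_induced: "multigraph ends F V \<Longrightarrow> X \<subseteq> V \<Longrightarrow> multigraph ends (induced ends F X) X"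
  by (auto simp: multigraph_def induced_def intro: finite_subset)

lemma multigraph_subset: "multigraph ends F V \<Longrightarrow> F' \<subseteq> F \<Longrightarrow> multigraph ends F' V"
  by (auto simp: multigraph_def intro: finite_subset)

lemma induced_induced: "Y \<subseteq> X \<Longrightarrow> induced ends (induced ends F X) Y = induced ends F Y"
  by (auto simp: induced_def)

lemma induced_self: "multigraph ends F V \<Longrightarrow> induced ends F V = F"
  by (auto simp: induced_def multigraph_def)

lemma finite_cross: "finite F \<Longrightarrow> finite (cross ends F P)"
  by (auto simp: cross_def)

lemma finite_odd_blocks: "finite P \<Longrightarrow> finite (odd_blocks ends F P)"
  by (auto simp: odd_blocks_def)

lemma card_edges_partition:
  assumes G: "multigraph ends F V" and P: "partition_on V P"
  shows "card F = card (cross ends F P) + (\<Sum>X\<in>P. card (induced ends F X))"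
proof -
  have fP: "finite P" and fF: "finite F" using G P finite_elements by (auto simp: multigraph_def)
  have "F = cross ends F P \<union> (\<Union>X\<in>P. induced ends F X)"
    by (auto simp: cross_def induced_def)
  moreover have "cross ends F P \<inter> (\<Union>X\<in>P. induced ends F X) = {}"
    by (auto simp: cross_def induced_def)
  moreover have "finite (cross ends F P)" "finite (\<Union>X\<in>P. induced ends F X)"
    using fF fP by (auto intro: finite_cross finite_induced)
  ultimately have "card F = card (cross ends F P) + card (\<Union>X\<in>P. induced ends F X)"
    by (metis card_Un_disjoint)
  also have "card (\<Union>X\<in>P. induced ends F X) = (\<Sum>X\<in>P. card (induced ends F X))"
  proof (rule card_UN_disjoint[OF fP])
    show "\<forall>X\<in>P. finite (induced ends F X)" using fF by (auto intro: finite_induced)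
    show "\<forall>X\<in>P. \<forall>Y\<in>P. X \<noteq> Y \<longrightarrow> induced ends F X \<inter> induced ends F Y = {}"
    proof (intro ballI impI)
      fix X Y assume "X \<in> P" "Y \<in> P" "X \<noteq> Y"
      then have "X \<inter> Y = {}" using partition_onD2[OF P] by (auto dest: disjointD)
      then show "induced ends F X \<inter> induced ends F Y = {}"
        using multigraph_nonempty[OF G] by (fastforce simp: induced_def)
    qed
  qed
  finally show ?thesis .
qed

text \<open>Modulo 2 the sum counts the odd values, and so does \<open>card P\<close> plus the
  number of even values.\<close>

lemma even_sum_card_even:
  fixes f :: "'a \<Rightarrow> nat"
  assumes "finite P"
  shows "even ((\<Sum>X\<in>P. f X) + card P + card {X \<in> P. even (f X)})"
  using assms
proof (induction rule: finite_induct)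
  case (insert x P)
  have "{X \<in> insert x P. even (f X)} = (if even (f x) then insert x {X \<in> P. even (f X)} else {X \<in> P. even (f X)})"
    by auto
  then show ?case using insert by auto
qed simp

text \<open>The parity of the slack in Nebesky's inequality depends on
  \<open>card F + card V\<close> only. If that sum is odd, a strict inequality has slack at least 2;
  if it is even, the inequality is never an equality.\<close>

lemma nebesky_parity:
  assumes G: "multigraph ends F V" and P: "partition_on V P"
  shows "even (card P + card (odd_blocks ends F P) + card F + card (cross ends F P) + card V)"
proof -
  have fP: "finite P" and fV: "finite V" using G P finite_elements by (auto simp: multigraph_def)
  have "card V = (\<Sum>X\<in>P. card X)"
    using product_partition[OF P] fV P by (metis finite_UnionD finite_subset partition_onD1 Union_upper)
  then have "(\<Sum>X\<in>P. card (induced ends F X) + card X) + card (cross ends F P) = card F + card V"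
    using card_edges_partition[OF G P] by (simp add: sum.distrib)
  moreover have "even ((\<Sum>X\<in>P. card (induced ends F X) + card X) + card P + card (odd_blocks ends F P))"
    unfolding odd_blocks_def by (rule even_sum_card_even[OF fP])
  moreover have "even (p + q + f + c + v)" if "s + c = f + v" "even (s + p + q)" for p q f c v s :: nat
    using that by presburger
  ultimately show ?thesis by blast
qed

text \<open>One deletion costs at most one unit of slack: a crossing edge leaves the blocks alone,
  and an inner edge changes the parity of a single block.\<close>

lemma odd_blocks_remove_edge:
  assumes G: "multigraph ends F V" and P: "partition_on V P" and e: "e \<in> F"
  shows "card (odd_blocks ends (F - {e}) P) + card (cross ends F P)
       \<le> card (odd_blocks ends F P) + card (cross ends (F - {e}) P) + 1"
proof (cases "e \<in> cross ends F P")
  case True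
  have fF: "finite F" using G by (auto simp: multigraph_def)
  have "induced ends (F - {e}) X = induced ends F X" if "X \<in> P" for X
    using True that by (auto simp: induced_def cross_def)
  then have "odd_blocks ends (F - {e}) P = odd_blocks ends F P" by (auto simp: odd_blocks_def)
  moreover have "cross ends (F - {e}) P = cross ends F P - {e}" by (auto simp: cross_def)
  then have "card (cross ends F P) = card (cross ends (F - {e}) P) + 1"
    using True finite_cross[OF fF] by (metis Suc_eq_plus1 card_Suc_Diff1)
  ultimately show ?thesis by simp
next
  case False
  have fP: "finite P" using G P finite_elements by (auto simp: multigraph_def)
  from False e obtain X0 where X0: "X0 \<in> P" "ends e \<subseteq> X0" by (auto simp: cross_def)
  have "induced ends (F - {e}) X = induced ends F X" if "X \<in> P" "X \<noteq> X0" for X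
  proof -
    have "X \<inter> X0 = {}" using that X0 partition_onD2[OF P] by (auto dest: disjointD)
    then have "\<not> ends e \<subseteq> X" using X0 multigraph_nonempty[OF G e] by auto
    then show ?thesis by (auto simp: induced_def)
  qed
  then have "odd_blocks ends (F - {e}) P \<subseteq> insert X0 (odd_blocks ends F P)"
    unfolding odd_blocks_def by (smt (verit) insert_iff mem_Collect_eq subsetI)
  then have "card (odd_blocks ends (F - {e}) P) \<le> card (insert X0 (odd_blocks ends F P))"
    using fP by (intro card_mono) (auto intro: finite_odd_blocks)
  also have "\<dots> \<le> card (odd_blocks ends F P) + 1" using card_insert_le_m1 by (simp add: card_insert_if finite_odd_blocks[OF fP])
  finally have "card (odd_blocks ends (F - {e}) P) \<le> card (odd_blocks ends F P) + 1" .
  moreover have "cross ends (F - {e}) P = cross ends F P" using False by (auto simp: cross_def)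
  ultimately show ?thesis by simp
qed

section \<open>Refining a partition inside one block\<close>

lemma partition_on_refine:
  assumes P: "partition_on V P" and X: "X \<in> P" and R: "partition_on X R"
  shows "partition_on V (P - {X} \<union> R)" and "(P - {X}) \<inter> R = {}"
proof -
  have d: "Y \<inter> Z = {}" if "Y \<in> P - {X}" "Z \<in> R" for Y Z
  proof -
    have "Y \<inter> X = {}" using that X partition_onD2[OF P] by (auto dest: disjointD)
    moreover have "Z \<subseteq> X" using that partition_onD1[OF R] by auto
    ultimately show ?thesis by auto
  qed
  show "(P - {X}) \<inter> R = {}"
  proof (rule ccontr)
    assume "(P - {X}) \<inter> R \<noteq> {}"
    then obtain Y where "Y \<in> P - {X}" "Y \<in> R" by auto
    then have "Y = {}" using d[of Y Y] by auto
    then show False using \<open>Y \<in> R\<close> partition_onD3[OF R] by auto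
  qed
  show "partition_on V (P - {X} \<union> R)"
  proof (rule partition_onI)
    show "\<Union> (P - {X} \<union> R) = V"
      using partition_onD1[OF P] partition_onD1[OF R] X by auto
    show "{} \<notin> P - {X} \<union> R" using partition_onD3[OF P] partition_onD3[OF R] by auto
    fix p q assume pq: "p \<in> P - {X} \<union> R" "q \<in> P - {X} \<union> R" "p \<noteq> q"
    have "p \<inter> q = {}" if "p \<in> P" "q \<in> P" using that pq partition_onD2[OF P] by (auto dest: disjointD)
    moreover have "p \<inter> q = {}" if "p \<in> R" "q \<in> R" using that pq partition_onD2[OF R] by (auto dest: disjointD)
    ultimately show "disjnt p q" using d[of p q] d[of q p] pq unfolding disjnt_def by blast
  qed
qed

text \<open>Together: the slack of \<open>Q\<close> is the slack of \<open>P\<close>, plus that of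
  \<open>R\<close> inside \<open>X\<close>, plus 1 if \<open>X\<close> is an odd block.\<close>

lemma refine_counts:
  assumes G: "multigraph ends F V" and P: "partition_on V P" and X: "X \<in> P" and R: "partition_on X R"
  defines "Q \<equiv> P - {X} \<union> R"
  shows "card Q + 1 = card P + card R"
    and "card (odd_blocks ends F Q) + card (odd_blocks ends F {X}) =
         card (odd_blocks ends F P) + card (odd_blocks ends (induced ends F X) R)"
    and "card (cross ends F Q) = card (cross ends F P) + card (cross ends (induced ends F X) R)"
proof -
  have fP: "finite P" and fV: "finite V" and fF: "finite F"
    using G P finite_elements by (auto simp: multigraph_def)
  have XV: "X \<subseteq> V" using X partition_onD1[OF P] by auto
  have fR: "finite R" using R fV XV finite_elements finite_subset by metis
  note dis = partition_on_refine(2)[OF P X R]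
  have RX: "Y \<subseteq> X" if "Y \<in> R" for Y using that partition_onD1[OF R] by auto
  show "card Q + 1 = card P + card R"
  proof -
    have "card Q = card (P - {X}) + card R"
      unfolding Q_def using fP fR dis by (intro card_Un_disjoint) auto
    moreover have "card (P - {X}) + 1 = card P" using fP X by (metis Suc_eq_plus1 card_Suc_Diff1)
    ultimately show ?thesis by simp
  qed
  have "odd_blocks ends (induced ends F X) R = odd_blocks ends F R"
    using RX by (auto simp: odd_blocks_def induced_induced)
  moreover have "odd_blocks ends F Q = odd_blocks ends F (P - {X}) \<union> odd_blocks ends F R"
    by (auto simp: odd_blocks_def Q_def)
  moreover have "odd_blocks ends F (P - {X}) \<inter> odd_blocks ends F R = {}"
    using dis by (auto simp: odd_blocks_def)
  moreover have "odd_blocks ends F P = odd_blocks ends F (P - {X}) \<union> odd_blocks ends F {X}"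
    using X by (auto simp: odd_blocks_def)
  moreover have "odd_blocks ends F (P - {X}) \<inter> odd_blocks ends F {X} = {}"
    by (auto simp: odd_blocks_def)
  moreover have "finite (odd_blocks ends F (P - {X}))" "finite (odd_blocks ends F R)" "finite (odd_blocks ends F {X})"
    using fP fR by (auto intro: finite_odd_blocks)
  ultimately show "card (odd_blocks ends F Q) + card (odd_blocks ends F {X}) =
         card (odd_blocks ends F P) + card (odd_blocks ends (induced ends F X) R)"
    by (simp add: card_Un_disjoint)
  have "cross ends F Q = cross ends F P \<union> cross ends (induced ends F X) R"
  proof (intro equalityI subsetI)
    fix e assume e: "e \<in> cross ends F Q"
    show "e \<in> cross ends F P \<union> cross ends (induced ends F X) R"
      using e unfolding cross_def induced_def Q_def by blast
  next
    fix e assume "e \<in> cross ends F P \<union> cross ends (induced ends F X) R"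
    then show "e \<in> cross ends F Q"
    proof
      assume "e \<in> cross ends F P"
      then show ?thesis using RX X by (fastforce simp: cross_def Q_def)
    next
      assume e: "e \<in> cross ends (induced ends F X) R"
      have "\<not> ends e \<subseteq> Y" if "Y \<in> P - {X}" for Y
      proof -
        have "Y \<inter> X = {}" using that X partition_onD2[OF P] by (auto dest: disjointD)
        then show ?thesis using e multigraph_nonempty[OF G, of e] by (auto simp: cross_def induced_def)
      qed
      then show ?thesis using e by (auto simp: cross_def induced_def Q_def)
    qed
  qed
  moreover have "cross ends F P \<inter> cross ends (induced ends F X) R = {}"
    using X by (auto simp: cross_def induced_def)
  ultimately show "card (cross ends F Q) = card (cross ends F P) + card (cross ends (induced ends F X) R)"
    using fF by (simp add: card_Un_disjoint finite_cross finite_induced)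
qed

lemma multigraph_cross_whole: "multigraph ends F V \<Longrightarrow> cross ends F {V} = {}"
  by (auto simp: multigraph_def cross_def)

lemma odd_blocks_whole:
  "multigraph ends F V \<Longrightarrow> odd_blocks ends F {V} = (if even (card F + card V) then {V} else {})"
  by (auto simp: odd_blocks_def induced_self)

lemma partition_on_card_ge_2:
  assumes "finite V" "partition_on V P" "P \<noteq> {V}" "V \<noteq> {}"
  shows "card P \<ge> 2"
proof (rule ccontr)
  assume "\<not> ?thesis"
  then consider "card P = 0" | "card P = 1" by linarith
  then show False
  proof cases
    case 1
    then show False using assms finite_elements partition_onD1 by fastforce
  next
    case 2
    then obtain X where "P = {X}" using card_1_singletonE by blast
    then show False using assms partition_onD1 by fastforce
  qed
qed

lemma partition_on_pair:
  assumes "A \<subseteq> V" "A \<noteq> {}" "A \<noteq> V"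
  shows "partition_on V {A, V - A}" and "card {A, V - A} = 2"
  using assms by (auto simp: partition_on_def disjoint_def card_2_iff)

text \<open>The trivial partition has no crossing edge, so its only block must not be odd: the cycle
  rank is even.\<close>

lemma nebesky_odd:
  assumes "multigraph ends F V" "V \<noteq> {}" "nebesky ends F V"
  shows "odd (card F + card V)"
proof -
  have "card {V} + card (odd_blocks ends F {V}) \<le> card (cross ends F {V}) + 1"
    using assms(3) partition_on_space[OF assms(2)] unfolding nebesky_def by blast
  then show ?thesis using multigraph_cross_whole[OF assms(1)] odd_blocks_whole[OF assms(1)]
    by (auto split: if_splits)
qed

lemma nebeskyI:
  assumes G: "multigraph ends F V" and "odd (card F + card V)"
    and "\<And>R. partition_on V R \<Longrightarrow> R \<noteq> {V} \<Longrightarrow>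
      card R + card (odd_blocks ends F R) \<le> card (cross ends F R) + 1"
  shows "nebesky ends F V"
  unfolding nebesky_def
proof (intro allI impI)
  fix R assume R: "partition_on V R"
  show "card R + card (odd_blocks ends F R) \<le> card (cross ends F R) + 1"
  proof (cases "R = {V}")
    case True
    then show ?thesis using multigraph_cross_whole[OF G] odd_blocks_whole[OF G] assms(2) by simp
  qed (use assms(3) R in auto)
qed

text \<open>The base case, in which no two edges are adjacent. The criterion forces connectedness,
  so only a single vertex or a single edge remains and nothing has to be deleted.\<close>

lemma nebesky_matching_sparse:
  assumes G: "multigraph ends F V" and "V \<noteq> {}" and N: "nebesky ends F V"
    and dis: "\<And>e f. e \<in> F \<Longrightarrow> f \<in> F \<Longrightarrow> e \<noteq> f \<Longrightarrow> ends e \<inter> ends f = {}"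
  shows "card V \<le> card F + 1" and "sparse ends F V"
proof -
  have fV: "finite V" using G by (auto simp: multigraph_def)
  have "card V \<le> card F + 1 \<and> sparse ends F V"
  proof (cases "F = {}")
    case True
    have "card ((\<lambda>x. {x}) ` V) \<le> card (cross ends F ((\<lambda>x. {x}) ` V)) + 1"
      using N partition_on_singletons[of V] unfolding nebesky_def by (meson add_leD1)
    moreover have "cross ends F ((\<lambda>x. {x}) ` V) = {}" using True by (simp add: cross_def)
    ultimately have "card ((\<lambda>x. {x}) ` V) \<le> 1" by simp
    then have "card V \<le> 1" by (simp add: card_image)
    moreover have "sparse ends F V"
      using True finite_subset[OF _ fV] by (simp add: sparse_def induced_def card_gt_0_iff)
    ultimately show ?thesis by simp
  next
    case False
    then obtain e where e: "e \<in> F" by auto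
    have ce: "card (ends e) = 2" "ends e \<subseteq> V" using G e by (auto simp: multigraph_def)
    have Ve: "V = ends e"
    proof (rule ccontr)
      assume "V \<noteq> ends e"
      moreover have "ends e \<noteq> {}" using ce by auto
      ultimately have p: "partition_on V {ends e, V - ends e}" "card {ends e, V - ends e} = 2"
        using partition_on_pair[of "ends e" V] ce(2) by metis+
      have "f \<notin> cross ends F {ends e, V - ends e}" if "f \<in> F" for f
        using dis[OF e that] G that by (cases "e = f") (auto simp: cross_def multigraph_def)
      then have "cross ends F {ends e, V - ends e} = {}" by (auto simp: cross_def)
      moreover have "card {ends e, V - ends e} \<le> card (cross ends F {ends e, V - ends e}) + 1"
        using N p(1) unfolding nebesky_def by (meson add_leD1)
      ultimately show False using p(2) by simp
    qed
    have "f = e" if "f \<in> F" for f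
    proof (rule ccontr)
      assume "f \<noteq> e"
      then have "ends e \<inter> ends f = {}" using dis e that by auto
      moreover have "ends f \<subseteq> ends e" "ends f \<noteq> {}" using G that Ve by (auto simp: multigraph_def)
      ultimately show False by auto
    qed
    then have F: "F = {e}" using e by blast
    have "card (induced ends F Z) < card Z" if "Z \<subseteq> V" "Z \<noteq> {}" for Z
    proof (cases "Z = V")
      case True
      have "card (induced ends F Z) \<le> card F" using F by (intro card_mono induced_subset) simp
      then show ?thesis using True Ve ce F by simp
    next
      case False
      then have "induced ends F Z = {}" using F Ve that by (auto simp: induced_def)
      moreover have "finite Z" using that fV finite_subset by auto
      ultimately show ?thesis using that by (simp add: card_gt_0_iff)
    qed
    then show ?thesis using ce Ve F by (simp add: sparse_def)
  qed
  then show "card V \<le> card F + 1" "sparse ends F V" by auto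
qed

text \<open>By parity every partition that is not tight has slack at least 2, which pays for two
  deletions.\<close>

lemma nebesky_remove_pair:
  assumes G: "multigraph ends F V" and V: "V \<noteq> {}" and N: "nebesky ends F V"
    and strict: "\<And>R. partition_on V R \<Longrightarrow> R \<noteq> {V} \<Longrightarrow>
      card R + card (odd_blocks ends F R) \<noteq> card (cross ends F R) + 1"
    and ef: "e \<in> F" "f \<in> F" "e \<noteq> f"
  shows "nebesky ends (F - {e, f}) V"
proof (rule nebeskyI)
  have fF: "finite F" using G by (auto simp: multigraph_def)
  have c: "card (F - {e, f}) + 2 = card F"
    using card_Diff_subset[of "{e, f}" F] card_mono[OF fF, of "{e, f}"] ef by auto
  have o: "odd (card F + card V)" by (rule nebesky_odd[OF G V N])
  show "odd (card (F - {e, f}) + card V)" using o c by presburger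
  show "multigraph ends (F - {e, f}) V" using multigraph_subset[OF G] by blast
  fix R assume R: "partition_on V R" "R \<noteq> {V}"
  have G1: "multigraph ends (F - {e}) V" using multigraph_subset[OF G] by blast
  have 1: "card (odd_blocks ends (F - {e}) R) + card (cross ends F R)
       \<le> card (odd_blocks ends F R) + card (cross ends (F - {e}) R) + 1"
    by (rule odd_blocks_remove_edge[OF G R(1) ef(1)])
  have 2: "card (odd_blocks ends (F - {e} - {f}) R) + card (cross ends (F - {e}) R)
       \<le> card (odd_blocks ends (F - {e}) R) + card (cross ends (F - {e} - {f}) R) + 1"
    by (rule odd_blocks_remove_edge[OF G1 R(1)]) (use ef in auto)
  have "card R + card (odd_blocks ends F R) \<le> card (cross ends F R) + 1"
    using N R by (auto simp: nebesky_def)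
  moreover note strict[OF R] nebesky_parity[OF G R(1)]
  moreover have "p + q + 1 \<le> c"
    if "p + q \<le> c + 1" "p + q \<noteq> c + 1" "even (p + q + f + c + v)" "odd (f + v)" for p q c f v :: nat
    using that by presburger
  ultimately have "card R + card (odd_blocks ends F R) + 1 \<le> card (cross ends F R)"
    using o by blast
  moreover have "F - {e} - {f} = F - {e, f}" by auto
  ultimately show "card R + card (odd_blocks ends (F - {e, f}) R) \<le> card (cross ends (F - {e, f}) R) + 1"
    using 1 2 by simp
qed

text \<open>By parity the inequality is strict on nontrivial partitions, so any one edge may go, and
  its deletion repairs the trivial partition. The partition that isolates \<open>w\<close> is
  crossed by some edge, which supplies one at \<open>w\<close>; a lone vertex carries no edge and is
  not an odd block.\<close>

lemma odd_block_edge: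
  assumes G: "multigraph ends F X" and ev: "even (card F + card X)" and w: "w \<in> X"
    and R: "\<And>R. partition_on X R \<Longrightarrow> R \<noteq> {X} \<Longrightarrow>
      card R + card (odd_blocks ends F R) \<le> card (cross ends F R) + 1"
  shows "\<exists>e \<in> F. w \<in> ends e \<and> nebesky ends (F - {e}) X"
proof -
  have fF: "finite F" using G by (auto simp: multigraph_def)
  have R': "card R + card (odd_blocks ends F R) \<le> card (cross ends F R)"
    if "partition_on X R" "R \<noteq> {X}" for R
  proof -
    have "p + q \<le> c" if "p + q \<le> c + 1" "even (p + q + f + c + v)" "even (f + v)" for p q c f v :: nat
      using that by presburger
    then show ?thesis using R[OF that] nebesky_parity[OF G that(1)] ev by blast
  qed
  have "X \<noteq> {w}"
  proof
    assume X: "X = {w}"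
    have "F = {}"
    proof (rule ccontr)
      assume "F \<noteq> {}"
      then obtain e where "e \<in> F" by auto
      then have "ends e \<subseteq> {w}" "card (ends e) = 2" using G X by (auto simp: multigraph_def)
      then show False using card_mono[of "{w}" "ends e"] by simp
    qed
    then show False using ev X by simp
  qed
  then have p: "partition_on X {{w}, X - {w}}" "card {{w}, X - {w}} = 2"
    using partition_on_pair[of "{w}" X] w by auto
  moreover have "{{w}, X - {w}} \<noteq> {X}" using p(2) by auto
  ultimately have "cross ends F {{w}, X - {w}} \<noteq> {}" using R' by fastforce
  then obtain e where e: "e \<in> F" "\<not> ends e \<subseteq> X - {w}" by (auto simp: cross_def)
  then have we: "w \<in> ends e" using G by (auto simp: multigraph_def)
  have "nebesky ends (F - {e}) X"
  proof (rule nebeskyI)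
    show "multigraph ends (F - {e}) X" using multigraph_subset[OF G] by blast
    have "card (F - {e}) + 1 = card F" using fF e by (metis Suc_eq_plus1 card_Suc_Diff1)
    then show "odd (card (F - {e}) + card X)" using ev by presburger
    fix R assume r: "partition_on X R" "R \<noteq> {X}"
    show "card R + card (odd_blocks ends (F - {e}) R) \<le> card (cross ends (F - {e}) R) + 1"
      using odd_blocks_remove_edge[OF G r(1) e(1)] R'[OF r] by linarith
  qed
  then show ?thesis using e we by auto
qed

text \<open>If \<open>Z\<close> meets \<open>k\<close> blocks, it spans at most
  \<open>card Z - k\<close> edges inside them and at most \<open>k - 1\<close> between them.\<close>

lemma sparse_glue:
  assumes G: "multigraph ends F V" and P: "partition_on V P"
    and blocks: "\<And>X. X \<in> P \<Longrightarrow> sparse ends (induced ends F X) X"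
    and quot: "sparse (\<lambda>e. {X \<in> P. ends e \<inter> X \<noteq> {}}) (cross ends F P) P"
  shows "sparse ends F V"
  unfolding sparse_def
proof (intro allI impI)
  fix Z assume Z: "Z \<subseteq> V" "Z \<noteq> {}"
  have fV: "finite V" and fF: "finite F" and fP: "finite P"
    using G P finite_elements by (auto simp: multigraph_def)
  have fZ: "finite Z" using Z fV finite_subset by auto
  define PZ where "PZ = {X \<in> P. Z \<inter> X \<noteq> {}}"
  have fPZ: "finite PZ" using fP by (simp add: PZ_def)
  define D where "D = induced (\<lambda>e. {X \<in> P. ends e \<inter> X \<noteq> {}}) (cross ends F P) PZ"
  have "induced ends F Z \<subseteq> D \<union> (\<Union>X\<in>PZ. induced ends F (Z \<inter> X))"
  proof
    fix e assume e: "e \<in> induced ends F Z"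
    show "e \<in> D \<union> (\<Union>X\<in>PZ. induced ends F (Z \<inter> X))"
    proof (cases "e \<in> cross ends F P")
      case True
      then have "e \<in> D" using e by (auto simp: D_def induced_def PZ_def)
      then show ?thesis by simp
    next
      case False
      then obtain X where X: "X \<in> P" "ends e \<subseteq> X" using e by (auto simp: induced_def cross_def)
      then have "X \<in> PZ" "e \<in> induced ends F (Z \<inter> X)"
        using e multigraph_nonempty[OF G, of e] by (auto simp: PZ_def induced_def)
      then show ?thesis by auto
    qed
  qed
  then have "card (induced ends F Z) \<le> card (D \<union> (\<Union>X\<in>PZ. induced ends F (Z \<inter> X)))"
    using fPZ fF by (intro card_mono) (auto simp: D_def intro!: finite_induced finite_cross)
  also have "\<dots> \<le> card D + card (\<Union>X\<in>PZ. induced ends F (Z \<inter> X))" by (rule card_Un_le)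
  also have "\<dots> \<le> card D + (\<Sum>X\<in>PZ. card (induced ends F (Z \<inter> X)))"
    using card_UN_le[OF fPZ] by auto
  finally have 1: "card (induced ends F Z) \<le> card D + (\<Sum>X\<in>PZ. card (induced ends F (Z \<inter> X)))" .
  have "Z = (\<Union>X\<in>PZ. Z \<inter> X)" using Z partition_onD1[OF P] by (auto simp: PZ_def)
  moreover have "card (\<Union>X\<in>PZ. Z \<inter> X) = (\<Sum>X\<in>PZ. card (Z \<inter> X))"
  proof (rule card_UN_disjoint[OF fPZ])
    show "\<forall>X\<in>PZ. finite (Z \<inter> X)" using fZ by auto
    show "\<forall>X\<in>PZ. \<forall>Y\<in>PZ. X \<noteq> Y \<longrightarrow> (Z \<inter> X) \<inter> (Z \<inter> Y) = {}"
    proof (intro ballI impI)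
      fix X Y assume "X \<in> PZ" "Y \<in> PZ" "X \<noteq> Y"
      then have "X \<inter> Y = {}" using partition_onD2[OF P] by (auto simp: PZ_def dest: disjointD)
      then show "(Z \<inter> X) \<inter> (Z \<inter> Y) = {}" by auto
    qed
  qed
  ultimately have 2: "card Z = (\<Sum>X\<in>PZ. card (Z \<inter> X))" by simp
  have "card (induced ends F (Z \<inter> X)) + 1 \<le> card (Z \<inter> X)" if "X \<in> PZ" for X
  proof -
    have "Z \<inter> X \<noteq> {}" "X \<in> P" using that by (auto simp: PZ_def)
    then have "card (induced ends (induced ends F X) (Z \<inter> X)) < card (Z \<inter> X)"
      using blocks[of X] unfolding sparse_def by blast
    then show ?thesis by (simp add: induced_induced)
  qed
  then have "(\<Sum>X\<in>PZ. card (induced ends F (Z \<inter> X)) + 1) \<le> (\<Sum>X\<in>PZ. card (Z \<inter> X))"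
    by (intro sum_mono) auto
  then have 3: "(\<Sum>X\<in>PZ. card (induced ends F (Z \<inter> X))) + card PZ \<le> card Z"
    using 2 by (simp add: sum_Suc)
  have "PZ \<noteq> {}" using Z partition_onD1[OF P] by (auto simp: PZ_def)
  then have "card D < card PZ" using quot unfolding D_def sparse_def PZ_def by auto
  then show "card (induced ends F Z) < card Z" using 1 3 by linarith
qed

lemma cross_ends_blocks:
  assumes G: "multigraph ends F V" and P: "partition_on V P" and e: "e \<in> cross ends F P"
  shows "card {X \<in> P. ends e \<inter> X \<noteq> {}} = 2"
proof -
  have "card (ends e) = 2" and sub: "ends e \<subseteq> V"
    using G e by (auto simp: multigraph_def cross_def)
  then obtain x y where xy: "ends e = {x, y}" by (auto simp: card_2_iff)
  obtain X Y where X: "X \<in> P" "x \<in> X" and Y: "Y \<in> P" "y \<in> Y"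
    using xy sub partition_onD1[OF P] by auto
  have un: "A = B" if "A \<in> P" "B \<in> P" "z \<in> A" "z \<in> B" for A B z
    using that partition_onD2[OF P] by (auto dest: disjointD)
  have "X \<noteq> Y" using e xy X Y by (auto simp: cross_def)
  moreover have "{X \<in> P. ends e \<inter> X \<noteq> {}} = {X, Y}"
    using xy X Y un by auto
  ultimately show ?thesis by simp
qed

text \<open>Merge the blocks in \<open>Z\<close> into one and compare the criterion for this coarser
  partition with tightness of \<open>P\<close>. At most the odd blocks in \<open>Z\<close> are lost,
  and the edges of the quotient inside \<open>Z\<close> cease to cross. The result is the hypothesis
  of \<open>sparse_transversal\<close>.\<close>

lemma tight_quotient_count:
  assumes G: "multigraph ends F V" and P: "partition_on V P" and N: "nebesky ends F V"
    and tight: "card P + card (odd_blocks ends F P) = card (cross ends F P) + 1"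
    and Z: "Z \<subseteq> P" "Z \<noteq> {}"
  shows "card (induced (\<lambda>e. {X \<in> P. ends e \<inter> X \<noteq> {}}) (cross ends F P) Z) + 1
    \<le> card Z + card (Z \<inter> odd_blocks ends F P)"
proof -
  let ?D = "cross ends F P" and ?O = "odd_blocks ends F P"
  let ?I = "induced (\<lambda>e. {X \<in> P. ends e \<inter> X \<noteq> {}}) ?D Z"
  have fF: "finite F" and fP: "finite P" using G P finite_elements by (auto simp: multigraph_def)
  define Q where "Q = insert (\<Union>Z) (P - Z)"
  have dis: "\<Union>Z \<inter> X = {}" if "X \<in> P - Z" for X
    using that Z partition_onD2[OF P] by (auto dest: disjointD)
  have ne: "\<Union>Z \<noteq> {}" using Z partition_onD3[OF P] by (metis Sup_upper ex_in_conv subsetD subset_empty)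
  have Q: "partition_on V Q"
  proof (rule partition_onI)
    show "\<Union>Q = V" using Z partition_onD1[OF P] by (auto simp: Q_def)
    show "{} \<notin> Q" using ne partition_onD3[OF P] by (auto simp: Q_def)
    fix p q assume pq: "p \<in> Q" "q \<in> Q" "p \<noteq> q"
    show "disjnt p q"
    proof (cases "p = \<Union>Z \<or> q = \<Union>Z")
      case True
      then show ?thesis using pq dis[of p] dis[of q] by (auto simp: Q_def disjnt_def)
    next
      case False
      then have "p \<in> P" "q \<in> P" using pq by (auto simp: Q_def)
      then show ?thesis using pq partition_onD2[OF P] by (auto simp: disjnt_def dest: disjointD)
    qed
  qed
  have "\<Union>Z \<notin> P - Z" using dis[of "\<Union>Z"] ne by auto
  then have cQ: "card Q + card Z = card P + 1"
    using fP Z card_Diff_subset[of Z P] card_mono[of P Z] finite_subset[OF Z(1) fP] by (simp add: Q_def)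
  have "?O - Z \<subseteq> odd_blocks ends F Q" by (auto simp: odd_blocks_def Q_def)
  then have "card (?O - Z) \<le> card (odd_blocks ends F Q)"
    using fP by (intro card_mono finite_odd_blocks) (simp add: Q_def)
  moreover have "card ?O = card (?O - Z) + card (Z \<inter> ?O)"
    using card_Int_Diff[OF finite_odd_blocks[OF fP], of ends F Z] by (simp add: Int_commute)
  ultimately have cO: "card ?O \<le> card (odd_blocks ends F Q) + card (Z \<inter> ?O)" by simp
  have "cross ends F Q \<subseteq> ?D - ?I"
  proof
    fix e assume e: "e \<in> cross ends F Q"
    have "ends e \<subseteq> \<Union>Z" if "{X \<in> P. ends e \<inter> X \<noteq> {}} \<subseteq> Z"
    proof
      fix x assume x: "x \<in> ends e"
      have "ends e \<subseteq> V" using e G by (simp add: cross_def multigraph_def)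
      then have "x \<in> \<Union>P" using x partition_onD1[OF P] by blast
      then show "x \<in> \<Union>Z" using that x by blast
    qed
    moreover have "\<not> ends e \<subseteq> X" if "X \<in> P" for X
      using that e by (cases "X \<in> Z") (auto simp: cross_def Q_def)
    ultimately show "e \<in> ?D - ?I" using e by (auto simp: cross_def induced_def Q_def)
  qed
  then have "card (cross ends F Q) \<le> card (?D - ?I)"
    using fF by (intro card_mono) (auto intro: finite_cross)
  moreover have "card (?D - ?I) + card ?I = card ?D"
    using card_Int_Diff[OF finite_cross[OF fF], of ends P ?I] Int_absorb1[OF induced_subset[of _ ?D Z]]
    by simp
  moreover have "card Q + card (odd_blocks ends F Q) \<le> card (cross ends F Q) + 1"
    using N Q by (auto simp: nebesky_def)
  ultimately show ?thesis using cQ cO tight by linarith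
qed

text \<open>Induction on the number of edges, through a tight partition with as many blocks as possible.
  If it is trivial, two adjacent edges can be deleted and their common vertex put into \<open>J\<close>. Otherwise
  every block either satisfies the criterion or does so after deletion of any one of its edges; each block of
  the second kind is assigned a crossing edge, which is paired with an edge of the block at a common vertex.\<close>

theorem nebesky_imp_sparse_complement:
  assumes "multigraph ends F V" "V \<noteq> {}" "nebesky ends F V"
  shows "\<exists>J \<subseteq> V. 2 * card J + card V \<le> card F + 1 \<and> sparse ends {e \<in> F. ends e \<inter> J = {}} V"
  using assms
proof (induction "card F" arbitrary: F V rule: less_induct)
  case less
  note G = less.prems(1) and V = less.prems(2) and N = less.prems(3)
  have fV: "finite V" and fF: "finite F" using G by (auto simp: multigraph_def)
  define tight where "tight P \<longleftrightarrow> partition_on V P \<and>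
    card P + card (odd_blocks ends F P) = card (cross ends F P) + 1" for P
  have "tight {V}"
    using multigraph_cross_whole[OF G] odd_blocks_whole[OF G] nebesky_odd[OF G V N] partition_on_space[OF V]
    by (simp add: tight_def)
  moreover have "\<forall>P. tight P \<longrightarrow> card P < Suc (card V)"
  proof (intro allI impI)
    fix P assume "tight P"
    then have P: "partition_on V P" by (simp add: tight_def)
    have "card P = (\<Sum>X\<in>P. 1)" by simp
    also have "\<dots> \<le> (\<Sum>X\<in>P. card X)"
    proof (rule sum_mono)
      fix X assume "X \<in> P"
      then have "X \<noteq> {}" "X \<subseteq> V" using partition_onD1[OF P] partition_onD3[OF P] by auto
      moreover from this have "finite X" using fV finite_subset by blast
      ultimately show "1 \<le> card X" by (simp add: Suc_le_eq card_gt_0_iff)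
    qed
    also have "\<dots> = card V"
      using product_partition[OF P] fV partition_onD1[OF P] by (metis Union_upper finite_subset)
    finally show "card P < Suc (card V)" by simp
  qed
  ultimately obtain P where P: "tight P" and maxP: "\<And>Q. tight Q \<Longrightarrow> card Q \<le> card P"
    using ex_has_greatest_nat[of tight "{V}" card "Suc (card V)"] by blast
  have pP: "partition_on V P" and tP: "card P + card (odd_blocks ends F P) = card (cross ends F P) + 1"
    using P by (auto simp: tight_def)
  have fP: "finite P" using fV pP finite_elements by auto
  show ?case
  proof (cases "P = {V}")
    case True
    \<comment> \<open>Any other partition has at least two blocks, so by the choice of
      \<open>P\<close> it is not tight.\<close>
    have strict: "card R + card (odd_blocks ends F R) \<noteq> card (cross ends F R) + 1"
      if "partition_on V R" "R \<noteq> {V}" for R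
      using that partition_on_card_ge_2[OF fV that V] maxP[of R] True by (auto simp: tight_def)
    show ?thesis
    proof (cases "\<exists>e\<in>F. \<exists>f\<in>F. e \<noteq> f \<and> ends e \<inter> ends f \<noteq> {}")
      case False
      then show ?thesis using nebesky_matching_sparse[OF G V N] by (intro exI[of _ "{}"]) fastforce
    next
      case True
      then obtain e f w where ef: "e \<in> F" "f \<in> F" "e \<noteq> f" "w \<in> ends e" "w \<in> ends f" by auto
      have c: "card (F - {e, f}) + 2 = card F"
        using card_Diff_subset[of "{e, f}" F] card_mono[OF fF, of "{e, f}"] ef by auto
      have "\<exists>J\<subseteq>V. 2 * card J + card V \<le> card (F - {e, f}) + 1 \<and>
          sparse ends {d \<in> F - {e, f}. ends d \<inter> J = {}} V"
        by (rule less.hyps) (use c multigraph_subset[OF G] V nebesky_remove_pair[OF G V N strict ef(1,2,3)] in auto)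
      then obtain J where J: "J \<subseteq> V" "2 * card J + card V \<le> card (F - {e, f}) + 1"
          "sparse ends {d \<in> F - {e, f}. ends d \<inter> J = {}} V" by blast
      have "finite J" using J(1) fV finite_subset by blast
      then have "card (insert w J) \<le> card J + 1" by (simp add: card_insert_if)
      moreover have "sparse ends {d \<in> F. ends d \<inter> insert w J = {}} V"
        by (rule sparse_mono[OF _ _ J(3)]) (use fF ef in auto)
      moreover have "insert w J \<subseteq> V" using J ef G by (auto simp: multigraph_def)
      ultimately show ?thesis using J c by (intro exI[of _ "insert w J"]) auto
    qed
  next
    case False
    let ?D = "cross ends F P" and ?O = "odd_blocks ends F P"
    let ?q = "\<lambda>e. {X \<in> P. ends e \<inter> X \<noteq> {}}"
    have P2: "card P \<ge> 2" by (rule partition_on_card_ge_2[OF fV pP False V])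
    have blk: "X \<subseteq> V" "X \<noteq> {}" "multigraph ends (induced ends F X) X" if "X \<in> P" for X
      using that partition_onD1[OF pP] partition_onD3[OF pP] multigraph_induced[OF G] by auto
    \<comment> \<open>A tight partition with at least two blocks has a crossing edge, so every block
      is within reach of the induction hypothesis.\<close>
    have small: "card (induced ends F X) < card F" if "X \<in> P" for X
    proof -
      have "card (induced ends F X) \<le> (\<Sum>X\<in>P. card (induced ends F X))"
        using fP that by (intro member_le_sum) auto
      then show ?thesis using card_edges_partition[OF G pP] tP P2 by linarith
    qed
    \<comment> \<open>Refining \<open>X\<close> by \<open>R\<close> would give more blocks than
      \<open>P\<close> has, so the refinement has positive slack, and \<open>refine_counts\<close>
      turns this into a statement about \<open>R\<close>.\<close>
    have sub: "card R + card (odd_blocks ends (induced ends F X) R) \<le>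
        card (cross ends (induced ends F X) R) + card (odd_blocks ends F {X})"
      if X: "X \<in> P" and R: "partition_on X R" "R \<noteq> {X}" for X R
    proof -
      note r = refine_counts[OF G pP X R(1)] and pQ = partition_on_refine(1)[OF pP X R(1)]
      have "finite X" using blk(1)[OF X] fV finite_subset by blast
      then have "card R \<ge> 2" using partition_on_card_ge_2 R blk(2)[OF X] by metis
      then have "card P < card (P - {X} \<union> R)" using r(1) by linarith
      then have "\<not> tight (P - {X} \<union> R)" using maxP not_less by blast
      then have "card (P - {X} \<union> R) + card (odd_blocks ends F (P - {X} \<union> R))
          \<noteq> card (cross ends F (P - {X} \<union> R)) + 1" using pQ by (simp add: tight_def)
      moreover have "card (P - {X} \<union> R) + card (odd_blocks ends F (P - {X} \<union> R))
          \<le> card (cross ends F (P - {X} \<union> R)) + 1" using N pQ by (simp add: nebesky_def)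
      ultimately show ?thesis using r tP by linarith
    qed
    have even_block: "\<exists>J\<subseteq>X. 2 * card J + card X \<le> card (induced ends F X) + 1 \<and>
        sparse ends {e \<in> induced ends F X. ends e \<inter> J = {}} X" if X: "X \<in> P" "X \<notin> ?O" for X
    proof (rule less.hyps)
      have o: "odd (card (induced ends F X) + card X)" using X by (auto simp: odd_blocks_def)
      then have "odd_blocks ends F {X} = {}" by (auto simp: odd_blocks_def)
      then show "nebesky ends (induced ends F X) X"
        using sub[OF X(1)] o blk(3)[OF X(1)] by (intro nebeskyI) (auto intro: le_SucI)
    qed (use X blk small in auto)
    \<comment> \<open>The vertex \<open>w\<close> is free to choose. The bound exceeds that for the
      other blocks by one, because \<open>w\<close> uses up only one edge inside \<open>X\<close>;
      its partner will be a crossing edge at \<open>w\<close>.\<close>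
    have odd_block: "\<exists>J\<subseteq>X. 2 * card J + card X \<le> card (induced ends F X) + 2 \<and> w \<in> J \<and>
        sparse ends {e \<in> induced ends F X. ends e \<inter> J = {}} X" if X: "X \<in> ?O" and w: "w \<in> X" for X w
    proof -
      have XP: "X \<in> P" and ev: "even (card (induced ends F X) + card X)" using X by (auto simp: odd_blocks_def)
      have "card (odd_blocks ends F {X}) \<le> card {X}" by (intro card_mono) (auto simp: odd_blocks_def)
      then have "card R + card (odd_blocks ends (induced ends F X) R) \<le>
        card (cross ends (induced ends F X) R) + 1" if "partition_on X R" "R \<noteq> {X}" for R
        using sub[OF XP that] by simp
      then obtain e where e: "e \<in> induced ends F X" "w \<in> ends e" "nebesky ends (induced ends F X - {e}) X"
        using odd_block_edge[OF blk(3)[OF XP] ev w] by blast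
      have c: "card (induced ends F X - {e}) + 1 = card (induced ends F X)"
        using e(1) finite_induced[OF fF] by (metis Suc_eq_plus1 card_Suc_Diff1)
      have "\<exists>J\<subseteq>X. 2 * card J + card X \<le> card (induced ends F X - {e}) + 1 \<and>
          sparse ends {d \<in> induced ends F X - {e}. ends d \<inter> J = {}} X"
      proof (rule less.hyps)
        show "card (induced ends F X - {e}) < card F" using c small[OF XP] by linarith
        show "multigraph ends (induced ends F X - {e}) X" using multigraph_subset[OF blk(3)[OF XP]] by blast
      qed (use blk(2)[OF XP] e in auto)
      then obtain J where J: "J \<subseteq> X" "2 * card J + card X \<le> card (induced ends F X - {e}) + 1"
          "sparse ends {d \<in> induced ends F X - {e}. ends d \<inter> J = {}} X" by blast
      have "finite J" using J(1) blk(1)[OF XP] fV finite_subset by metis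
      then have "card (insert w J) \<le> card J + 1" by (simp add: card_insert_if)
      moreover have "sparse ends {d \<in> induced ends F X. ends d \<inter> insert w J = {}} X"
      proof (rule sparse_mono[OF _ _ J(3)])
        show "finite {d \<in> induced ends F X - {e}. ends d \<inter> J = {}}"
          by (rule finite_subset[OF _ fF]) (auto simp: induced_def)
      qed (use e in auto)
      moreover have "insert w J \<subseteq> X" using J(1) w by blast
      moreover have "2 * card (insert w J) + card X \<le> card (induced ends F X) + 2"
        using J(2) c \<open>card (insert w J) \<le> card J + 1\<close> by linarith
      ultimately show ?thesis by blast
    qed
    have "\<exists>h. (\<forall>K\<in>?O. h K \<in> ?D \<and> K \<in> ?q (h K)) \<and> sparse ?q (?D - h ` ?O) P"
    proof (rule sparse_transversal[OF fP finite_cross[OF fF]])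
      show "?O \<subseteq> P" by (auto simp: odd_blocks_def)
      show "?q e \<subseteq> P \<and> card (?q e) = 2" if "e \<in> ?D" for e
        using cross_ends_blocks[OF G pP that] by auto
      show "card (induced ?q ?D Z) + 1 \<le> card Z + card (Z \<inter> ?O)" if "Z \<subseteq> P" "Z \<noteq> {}" for Z
        by (rule tight_quotient_count[OF G pP N tP that])
      show "card ?D + 1 = card P + card ?O" using tP by simp
    qed
    then obtain h where h: "\<forall>K\<in>?O. h K \<in> ?D \<and> K \<in> ?q (h K)" "sparse ?q (?D - h ` ?O) P" by blast
    have "\<exists>J\<subseteq>X. 2 * card J + card X \<le> card (induced ends F X) + 1 + (if X \<in> ?O then 1 else 0) \<and>
        (X \<in> ?O \<longrightarrow> ends (h X) \<inter> J \<noteq> {}) \<and>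
        sparse ends {e \<in> induced ends F X. ends e \<inter> J = {}} X" if X: "X \<in> P" for X
    proof (cases "X \<in> ?O")
      case True
      then obtain w where "w \<in> ends (h X)" "w \<in> X" using h(1) by blast
      then obtain J where J: "J \<subseteq> X" "2 * card J + card X \<le> card (induced ends F X) + 2" "w \<in> J"
        "sparse ends {e \<in> induced ends F X. ends e \<inter> J = {}} X"
        using odd_block[OF True, of w] by blast
      then have "ends (h X) \<inter> J \<noteq> {}" using \<open>w \<in> ends (h X)\<close> by blast
      then show ?thesis using J True by (intro exI[of _ J]) simp
    next
      case False
      then show ?thesis using even_block[OF X False] by simp
    qed
    then have "\<forall>X\<in>P. \<exists>J. J \<subseteq> X \<and> 2 * card J + card X \<le> card (induced ends F X) + 1 + (if X \<in> ?O then 1 else 0) \<and>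
        (X \<in> ?O \<longrightarrow> ends (h X) \<inter> J \<noteq> {}) \<and>
        sparse ends {e \<in> induced ends F X. ends e \<inter> J = {}} X" by blast
    from bchoice[OF this] obtain j where j: "\<forall>X\<in>P. j X \<subseteq> X \<and>
        2 * card (j X) + card X \<le> card (induced ends F X) + 1 + (if X \<in> ?O then 1 else 0) \<and>
        (X \<in> ?O \<longrightarrow> ends (h X) \<inter> j X \<noteq> {}) \<and>
        sparse ends {e \<in> induced ends F X. ends e \<inter> j X = {}} X" by blast
    define J where "J = (\<Union>X\<in>P. j X)"
    have JV: "J \<subseteq> V" using j blk(1) by (fastforce simp: J_def)
    have cV: "card V = (\<Sum>X\<in>P. card X)"
      using product_partition[OF pP] fV blk(1) by (metis finite_subset)
    have "card J \<le> (\<Sum>X\<in>P. card (j X))" unfolding J_def by (rule card_UN_le[OF fP])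
    then have "2 * card J + card V \<le> (\<Sum>X\<in>P. 2 * card (j X) + card X)"
      by (simp add: sum.distrib sum_distrib_left[symmetric] cV)
    also have "\<dots> \<le> (\<Sum>X\<in>P. card (induced ends F X) + 1 + (if X \<in> ?O then 1 else 0))"
      using j by (intro sum_mono) blast
    also have "\<dots> = (\<Sum>X\<in>P. card (induced ends F X)) + card P + (\<Sum>X\<in>P. if X \<in> ?O then 1 else 0)"
      by (simp only: sum.distrib card_eq_sum)
    also have "(\<Sum>X\<in>P. if X \<in> ?O then 1 else 0 :: nat) = card ?O"
    proof -
      have "P \<inter> ?O = ?O" by (auto simp: odd_blocks_def)
      moreover have "(\<Sum>X\<in>P. if X \<in> ?O then 1 else 0 :: nat) = sum (\<lambda>_. 1) (P \<inter> ?O)"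
        by (rule sum.inter_restrict[OF fP, symmetric])
      ultimately show ?thesis by (simp only: card_eq_sum)
    qed
    \<comment> \<open>By tightness the terms \<open>card P + card ?O\<close> amount to the number of
      crossing edges plus one, so the surplus of the odd blocks is paid by the edges assigned to
      them.\<close>
    finally have count: "2 * card J + card V \<le> card F + 1"
      using card_edges_partition[OF G pP] tP by linarith
    let ?F = "{e \<in> F. ends e \<inter> J = {}}"
    have "sparse ends ?F V"
    proof (rule sparse_glue[OF _ pP])
      show "multigraph ends ?F V" by (rule multigraph_subset[OF G]) auto
      show "sparse ends (induced ends ?F X) X" if X: "X \<in> P" for X
      proof (rule sparse_mono)
        show "sparse ends {e \<in> induced ends F X. ends e \<inter> j X = {}} X" using j X by blast
        show "finite {e \<in> induced ends F X. ends e \<inter> j X = {}}"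
          by (rule finite_subset[OF _ fF]) (auto simp: induced_def)
        have "j X \<subseteq> J" using X by (auto simp: J_def)
        then show "induced ends ?F X \<subseteq> {e \<in> induced ends F X. ends e \<inter> j X = {}}"
          unfolding induced_def by blast
      qed
      show "sparse ?q (cross ends ?F P) P"
      proof (rule sparse_mono[OF _ _ h(2)])
        show "finite (?D - h ` ?O)" by (intro finite_Diff finite_cross fF)
        \<comment> \<open>Each assigned crossing edge has an end in \<open>J\<close> and disappears,
          leaving a sparse quotient.\<close>
        have "h X \<notin> ?F" if "X \<in> ?O" for X
        proof -
          have "X \<in> P" using that by (simp add: odd_blocks_def)
          then have "j X \<subseteq> J" by (auto simp: J_def)
          moreover have "ends (h X) \<inter> j X \<noteq> {}" using that bspec[OF j \<open>X \<in> P\<close>] by simp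
          ultimately show ?thesis by blast
        qed
        moreover have "cross ends ?F P \<subseteq> ?D" "cross ends ?F P \<subseteq> ?F" by (auto simp: cross_def)
        ultimately show "cross ends ?F P \<subseteq> ?D - h ` ?O" by blast
      qed
    qed
    then show ?thesis using JV count by blast
  qed
qed

subsection \<open>Induced trees in cubic graphs\<close>

text \<open>The complement of \<open>J\<close> spans fewer edges than it has vertices by sparsity,
  but at least \<open>card F - 3 * card J\<close> by the degree bound. With
  \<open>2 * card J + card V \<le> card F + 1\<close> both estimates become equalities. The
  hypothesis \<open>small\<close> keeps \<open>J\<close> from being all of \<open>V\<close>.\<close>

lemma nebesky_induced_tree:
  assumes G: "multigraph ends F V" and V: "V \<noteq> {}" and N: "nebesky ends F V"
    and deg: "\<And>v. v \<in> V \<Longrightarrow> card {e \<in> F. v \<in> ends e} \<le> 3"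
    and small: "card F + 1 < 3 * card V"
  shows "\<exists>S \<subseteq> V. S \<noteq> {} \<and> sparse ends (induced ends F S) S \<and>
    card (induced ends F S) + 1 = card S \<and> 2 * card S + card F + 1 = 3 * card V"
proof -
  have fV: "finite V" and fF: "finite F" using G by (auto simp: multigraph_def)
  obtain J where J: "J \<subseteq> V" "2 * card J + card V \<le> card F + 1"
      and sp: "sparse ends {e \<in> F. ends e \<inter> J = {}} V"
    using nebesky_imp_sparse_complement[OF G V N] by blast
  have fJ: "finite J" using J fV finite_subset by blast
  define S where "S = V - J"
  have cS: "card S + card J = card V"
    unfolding S_def using J fV fJ card_mono[OF fV J(1)] by (simp add: card_Diff_subset)
  have "S \<noteq> {}"
  proof
    assume "S = {}"
    then have "card J = card V" using cS by simp
    then show False using J small by linarith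
  qed
  have ind: "induced ends F S = {e \<in> F. ends e \<inter> J = {}}"
    using G by (auto simp: induced_def S_def multigraph_def)
  have sS: "sparse ends (induced ends F S) S"
    unfolding sparse_def
  proof (intro allI impI)
    fix Z assume "Z \<subseteq> S" "Z \<noteq> {}"
    then show "card (induced ends (induced ends F S) Z) < card Z"
      using sp unfolding ind sparse_def by (auto simp: S_def)
  qed
  then have "card (induced ends (induced ends F S) S) < card S"
    using \<open>S \<noteq> {}\<close> unfolding sparse_def by blast
  then have up: "card (induced ends F S) < card S" by (simp add: induced_induced)
  have "F \<subseteq> induced ends F S \<union> (\<Union>v\<in>J. {e \<in> F. v \<in> ends e})"
    unfolding ind by auto
  then have "card F \<le> card (induced ends F S \<union> (\<Union>v\<in>J. {e \<in> F. v \<in> ends e}))"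
    using fF fJ by (intro card_mono) (auto intro: finite_induced)
  also have "\<dots> \<le> card (induced ends F S) + card (\<Union>v\<in>J. {e \<in> F. v \<in> ends e})"
    by (rule card_Un_le)
  also have "card (\<Union>v\<in>J. {e \<in> F. v \<in> ends e}) \<le> (\<Sum>v\<in>J. card {e \<in> F. v \<in> ends e})"
    by (rule card_UN_le[OF fJ])
  also have "\<dots> \<le> (\<Sum>v\<in>J. 3)" using J deg by (intro sum_mono) auto
  finally have low: "card F \<le> card (induced ends F S) + 3 * card J" by simp
  have "card (induced ends F S) + 1 = card S" "2 * card S + card F + 1 = 3 * card V"
    using up low cS J by linarith+
  then show ?thesis using sS \<open>S \<noteq> {}\<close> by (intro exI[of _ S]) (auto simp: S_def)
qed

lemma handshake:
  assumes G: "multigraph ends E V"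
  shows "(\<Sum>v\<in>V. card {e \<in> E. v \<in> ends e}) = 2 * card E"
proof -
  have fV: "finite V" and fE: "finite E" using G by (auto simp: multigraph_def)
  have "\<forall>e\<in>E. card {v \<in> V. v \<in> ends e} = 2"
  proof
    fix e assume "e \<in> E"
    then have "{v \<in> V. v \<in> ends e} = ends e" "card (ends e) = 2" using G by (auto simp: multigraph_def)
    then show "card {v \<in> V. v \<in> ends e} = 2" by simp
  qed
  then show ?thesis using sum_multicount[OF fV fE, of "\<lambda>v e. v \<in> ends e" 2] by simp
qed

text \<open>In a cubic graph $3 |X| - 2 e(X)$ is the number of edges leaving \<open>X\<close>.\<close>

locale cyclically_connected_cubic =
  fixes ends :: "'e \<Rightarrow> 'v set" and E V
  assumes G: "multigraph ends E V" and V: "V \<noteq> {}"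
    and deg: "\<And>v. v \<in> V \<Longrightarrow> card {e \<in> E. v \<in> ends e} = 3"
    and cut: "\<And>X. X \<subset> V \<Longrightarrow> X \<noteq> {} \<Longrightarrow> 2 * card (induced ends E X) + 3 \<le> 3 * card X"
    and cut3: "\<And>X. X \<subset> V \<Longrightarrow> 2 * card (induced ends E X) + 3 = 3 * card X \<Longrightarrow>
      card X = 1 \<or> card (V - X) = 1"
begin

lemma finite_V: "finite V" and finite_E: "finite E"
  using G by (auto simp: multigraph_def)

lemma card_E: "2 * card E = 3 * card V"
  using handshake[OF G] deg by simp

text \<open>As every boundary has size at least 3, only an odd block with boundary exactly 3 could
  fail. A single vertex has cycle rank 0, and \<open>V4\<close> takes care of the complement of a
  vertex.\<close>

lemma block_weight:
  assumes X: "X \<subset> V" "X \<noteq> {}" and V4: "card (V - X) = 1 \<Longrightarrow> card V mod 4 = 2"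
  shows "2 + 2 * (if even (card (induced ends E X) + card X) then 1 else 0)
    + 2 * card (induced ends E X) \<le> 3 * card X"
proof (cases "even (card (induced ends E X) + card X)")
  case True
  have "2 * card (induced ends E X) + 3 \<noteq> 3 * card X"
  proof
    assume eq: "2 * card (induced ends E X) + 3 = 3 * card X"
    then consider "card X = 1" | "card (V - X) = 1" using cut3 X by blast
    then show False
    proof cases
      case 1
      then show False using eq True by simp
    next
      case 2
      have "card (V - X) + card X = card V"
        using X finite_V by (metis card_Diff_subset card_mono finite_subset le_add_diff_inverse2 psubset_imp_subset)
      then have "card X mod 4 = 1" using V4[OF 2] 2 by presburger
      \<comment> \<open>Boundary 3 then gives $6q$ edges on $4q + 1$ vertices, an odd total, so
        \<open>X\<close> is not an odd block.\<close>
      then obtain q where "card X = 4 * q + 1" by (metis mult.commute mult_div_mod_eq)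
      moreover from this have "card (induced ends E X) = 6 * q" using eq by linarith
      ultimately show False using True by simp
    qed
  qed
  then show ?thesis using cut[OF X] True by simp
qed (use cut[OF X] in simp)

lemma sum_odd_blocks:
  "finite P \<Longrightarrow> (\<Sum>X\<in>P. (if even (card (induced ends F X) + card X) then 1 else 0 :: nat)) = card (odd_blocks ends F P)"
  unfolding odd_blocks_def by (simp only: card_eq_sum sum.inter_filter)

text \<open>Each crossing edge is in the boundary of exactly two blocks, so
  \<open>block_weight\<close> summed over a partition and halved yields the criterion.\<close>

lemma induced_tree_2_mod_4:
  assumes m: "card V mod 4 = 2"
  shows "\<exists>S \<subseteq> V. S \<noteq> {} \<and> sparse ends (induced ends E S) S \<and>
    card (induced ends E S) + 1 = card S \<and> 4 * card S + 2 = 3 * card V"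
proof -
  have "nebesky ends E V"
  proof (rule nebeskyI[OF G])
    obtain q where "card V = 4 * q + 2" using m by (metis mult.commute mult_div_mod_eq)
    moreover from this have "card E = 6 * q + 3" using card_E by linarith
    ultimately show "odd (card E + card V)" by simp
    fix R assume R: "partition_on V R" "R \<noteq> {V}"
    have fR: "finite R" using finite_V R finite_elements by auto
    have "2 + 2 * (if even (card (induced ends E X) + card X) then 1 else 0)
        + 2 * card (induced ends E X) \<le> 3 * card X" if X: "X \<in> R" for X
    proof (rule block_weight)
      show "X \<noteq> {}" using X partition_onD3[OF R(1)] by auto
      have "X \<noteq> V"
      proof
        assume "X = V"
        have "Y = V" if "Y \<in> R" for Y
        proof (rule ccontr)
          assume "Y \<noteq> V"
          then have "Y \<inter> V = {}" using that X \<open>X = V\<close> partition_onD2[OF R(1)] by (auto dest: disjointD)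
          moreover have "Y \<noteq> {}" "Y \<subseteq> V" using that partition_onD3[OF R(1)] partition_onD1[OF R(1)] by auto
          ultimately show False by auto
        qed
        then have "R = {V}" using X \<open>X = V\<close> by blast
        then show False using R by simp
      qed
      then show "X \<subset> V" using X partition_onD1[OF R(1)] by auto
    qed (use m in auto)
    then have "(\<Sum>X\<in>R. 2 + 2 * (if even (card (induced ends E X) + card X) then 1 else 0)
        + 2 * card (induced ends E X)) \<le> (\<Sum>X\<in>R. 3 * card X)" by (rule sum_mono)
    moreover have "(\<Sum>X\<in>R. 3 * card X) = 3 * card V"
      using product_partition[OF R(1)] finite_V partition_onD1[OF R(1)]
      by (metis Union_upper finite_subset sum_distrib_left)
    ultimately have "2 * card R + 2 * card (odd_blocks ends E R) + 2 * (\<Sum>X\<in>R. card (induced ends E X)) \<le> 3 * card V"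
      by (simp only: sum.distrib sum_distrib_left[symmetric] sum_odd_blocks[OF fR] sum_constant) simp
    then show "card R + card (odd_blocks ends E R) \<le> card (cross ends E R) + 1"
      using card_edges_partition[OF G R(1)] card_E by linarith
  qed
  moreover have "card V > 0" using V finite_V by (simp add: card_gt_0_iff)
  then have "card E + 1 < 3 * card V" using card_E by linarith
  ultimately obtain S where "S \<subseteq> V" "S \<noteq> {}" "sparse ends (induced ends E S) S"
      "card (induced ends E S) + 1 = card S" "2 * card S + card E + 1 = 3 * card V"
    using nebesky_induced_tree[OF G V] deg by (metis order_refl)
  then show ?thesis using card_E by (intro exI[of _ S]) auto
qed

text \<open>On \<open>W\<close> the sum of \<open>block_weight\<close> falls one unit short of the
  criterion. Some block must be strict, which supplies this unit: otherwise all blocks would be odd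
  with boundary 4, which forces 4 to divide their sizes and hence \<open>card W\<close>, although
  \<open>card W\<close> is 2 modulo 4.\<close>

lemma induced_tree_0_mod_4:
  assumes m: "card V mod 4 = 0"
  shows "\<exists>S \<subseteq> V. S \<noteq> {} \<and> sparse ends (induced ends E S) S \<and>
    card (induced ends E S) + 1 = card S \<and> 4 * card S + 4 = 3 * card V"
proof -
  have m4: "card V \<ge> 4" using m V finite_V
    by (metis card_gt_0_iff dvd_imp_le mod_0_imp_dvd)
  then have "card E > 0" using card_E by linarith
  then obtain e0 where e0: "e0 \<in> E" by (metis card.empty equals0I less_numeral_extra(3))
  then have "card (ends e0) = 2" "ends e0 \<subseteq> V" using G by (auto simp: multigraph_def)
  then obtain u v where uv: "ends e0 = {u, v}" "u \<noteq> v" "u \<in> V" "v \<in> V" by (auto simp: card_2_iff)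
  define W where "W = V - {u, v}"
  define F where "F = {e \<in> E. ends e \<inter> {u, v} = {}}"
  have cW: "card W + 2 = card V"
    unfolding W_def using uv finite_V m4 by (simp add: card_Diff_subset)
  then have W: "W \<noteq> {}" using m4 by auto
  have GF: "multigraph ends F W" using G by (auto simp: multigraph_def F_def W_def)
  have indF: "induced ends F X = induced ends E X" if "X \<subseteq> W" for X
    using that by (auto simp: induced_def F_def W_def)
  \<comment> \<open>The cut bound rules out parallel edges, so exactly $3 + 3 - 1 = 5$ edges are
    lost.\<close>
  have "card (induced ends E {u, v}) = 1"
  proof -
    have "{u, v} \<noteq> V" using m4 uv(2) by auto
    then have "{u, v} \<subset> V" using uv by blast
    then have "2 * card (induced ends E {u, v}) + 3 \<le> 3 * card {u, v}" by (intro cut) auto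
    moreover have "card (induced ends E {u, v}) > 0"
      using e0 uv finite_induced[OF finite_E] by (auto simp: card_gt_0_iff induced_def)
    ultimately show ?thesis using uv by simp
  qed
  moreover have "{e \<in> E. u \<in> ends e} \<inter> {e \<in> E. v \<in> ends e} = induced ends E {u, v}"
  proof (intro equalityI subsetI)
    fix e assume e: "e \<in> {e \<in> E. u \<in> ends e} \<inter> {e \<in> E. v \<in> ends e}"
    then have "{u, v} \<subseteq> ends e" "card (ends e) = 2" using G by (auto simp: multigraph_def)
    then have "ends e = {u, v}" using uv by (metis card_2_iff card_eq_0_iff card_subset_eq zero_neq_numeral)
    then show "e \<in> induced ends E {u, v}" using e by (simp add: induced_def)
  next
    fix e assume e: "e \<in> induced ends E {u, v}"
    then have "ends e \<subseteq> {u, v}" "card (ends e) = 2" using G by (auto simp: multigraph_def induced_def)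
    then have "ends e = {u, v}" using uv by (intro card_subset_eq) auto
    then show "e \<in> {e \<in> E. u \<in> ends e} \<inter> {e \<in> E. v \<in> ends e}" using e by (simp add: induced_def)
  qed
  ultimately have "card ({e \<in> E. u \<in> ends e} \<union> {e \<in> E. v \<in> ends e}) + 1 = 6"
    using card_Un_Int[of "{e \<in> E. u \<in> ends e}" "{e \<in> E. v \<in> ends e}"] finite_E deg uv by simp
  moreover have "card E = card F + card ({e \<in> E. u \<in> ends e} \<union> {e \<in> E. v \<in> ends e})"
  proof -
    have "E = F \<union> ({e \<in> E. u \<in> ends e} \<union> {e \<in> E. v \<in> ends e})"
      "F \<inter> ({e \<in> E. u \<in> ends e} \<union> {e \<in> E. v \<in> ends e}) = {}" by (auto simp: F_def)
    then show ?thesis using finite_E by (metis card_Un_disjoint finite_Un)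
  qed
  ultimately have cF: "card F + 5 = card E" by simp
  have "nebesky ends F W"
    unfolding nebesky_def
  proof (intro allI impI)
    fix R assume R: "partition_on W R"
    have fW: "finite W" using finite_V by (simp add: W_def)
    have fR: "finite R" using fW R finite_elements by auto
    \<comment> \<open>Every block misses both \<open>u\<close> and \<open>v\<close>, so the case
      \<open>V4\<close> of \<open>block_weight\<close> does not arise.\<close>
    have RW: "X \<subseteq> W" "X \<noteq> {}" "X \<subset> V" "card (V - X) \<noteq> 1" if "X \<in> R" for X
    proof -
      show 1: "X \<subseteq> W" "X \<noteq> {}" using that partition_onD3[OF R] partition_onD1[OF R] by auto
      then show "X \<subset> V" using uv by (auto simp: W_def)
      have "{u, v} \<subseteq> V - X" using 1 uv by (auto simp: W_def)
      then have "card {u, v} \<le> card (V - X)" using finite_V by (intro card_mono) auto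
      then show "card (V - X) \<noteq> 1" using uv by simp
    qed
    let ?w = "\<lambda>X. 2 + 2 * (if even (card (induced ends F X) + card X) then 1 else 0)
        + 2 * card (induced ends F X)"
    have w: "?w X \<le> 3 * card X" if X: "X \<in> R" for X
      using block_weight[of X] RW[OF X] indF[OF RW(1)[OF X]] by auto
    have sums: "(\<Sum>X\<in>R. card X) = card W"
      using product_partition[OF R] fW RW(1) by (metis finite_subset)
    have sw: "(\<Sum>X\<in>R. ?w X) = 2 * card R + 2 * card (odd_blocks ends F R) + 2 * (\<Sum>X\<in>R. card (induced ends F X))"
      by (simp only: sum.distrib sum_distrib_left[symmetric] sum_odd_blocks[OF fR] sum_constant) simp
    have "\<exists>X\<in>R. ?w X < 3 * card X"
    proof (rule ccontr)
      assume neg: "\<not> ?thesis"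
      have "4 dvd card X" if X: "X \<in> R" for X
      proof -
        have eq: "?w X = 3 * card X" using neg w[OF X] X by force
        \<comment> \<open>Boundary 2 is impossible, so equality leaves only an odd block with
          boundary 4.\<close>
        have c: "2 * card (induced ends F X) + 3 \<le> 3 * card X"
          using cut[of X] RW[OF X] indF by simp
        then have ev: "even (card (induced ends F X) + card X)" using eq by (auto split: if_splits)
        then have "4 + 2 * card (induced ends F X) = 3 * card X" using eq by simp
        moreover have "4 dvd x" if "4 + 2 * i = 3 * x" "even (i + x)" for i x :: nat
          using that by presburger
        ultimately show ?thesis using ev by blast
      qed
      then have "4 dvd card W" using sums by (metis dvd_sum)
      then show False using cW m by presburger
    qed
    then have "(\<Sum>X\<in>R. ?w X) < (\<Sum>X\<in>R. 3 * card X)"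
      using w fR by (intro sum_strict_mono_ex1) auto
    then have "2 * card R + 2 * card (odd_blocks ends F R) + 2 * (\<Sum>X\<in>R. card (induced ends F X)) < 3 * card W"
      using sums sw by (simp add: sum_distrib_left[symmetric])
    then show "card R + card (odd_blocks ends F R) \<le> card (cross ends F R) + 1"
      using card_edges_partition[OF GF R] cF cW card_E by linarith
  qed
  moreover have "card {e \<in> F. x \<in> ends e} \<le> 3" if "x \<in> W" for x
  proof -
    have "card {e \<in> F. x \<in> ends e} \<le> card {e \<in> E. x \<in> ends e}"
      using finite_E by (intro card_mono) (auto simp: F_def)
    then show ?thesis using deg[of x] that by (simp add: W_def)
  qed
  moreover have "card F + 1 < 3 * card W" using cF cW card_E m4 by linarith
  ultimately obtain S where S: "S \<subseteq> W" "S \<noteq> {}" "sparse ends (induced ends F S) S"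
      "card (induced ends F S) + 1 = card S" "2 * card S + card F + 1 = 3 * card W"
    using nebesky_induced_tree[OF GF W] by metis
  have "S \<subseteq> V" using S(1) by (auto simp: W_def)
  moreover have "4 * card S + 4 = 3 * card V" using S(5) cF cW card_E by linarith
  ultimately show ?thesis using S indF[OF S(1)] by metis
qed

end

subsection \<open>Edge cuts of the hexagon graph\<close>

text \<open>With \<open>c = b \<otimes> a\<close>, the hexagons of the Cayley graph are the closed walks
  \<open>x, x \<otimes> b, x \<otimes> c, x \<otimes> c \<otimes> b, \<dots>\<close> and correspond to the left cosets \<open>tri x\<close> of the subgroup
  generated by \<open>c\<close>. The hexagon graph has these cosets as vertices and the edges \<open>{x, x \<otimes> a}\<close>.\<close>

locale hexagonal = group G for G (structure) +
  fixes a c :: 'a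
  assumes fin: "finite (carrier G)"
    and a: "a \<in> carrier G" "a \<noteq> \<one>" "a \<otimes> a = \<one>"
    and c: "c \<in> carrier G" "c \<noteq> \<one>" "c \<otimes> c \<otimes> c = \<one>"
    and gen: "\<And>Y. Y \<subseteq> carrier G \<Longrightarrow> Y \<noteq> {} \<Longrightarrow> (\<And>x. x \<in> Y \<Longrightarrow> x \<otimes> a \<in> Y) \<Longrightarrow>
      (\<And>x. x \<in> Y \<Longrightarrow> x \<otimes> c \<in> Y) \<Longrightarrow> Y = carrier G"
begin

section \<open>Cosets and edges of the hexagon graph\<close>

lemma mult_aa: "x \<in> carrier G \<Longrightarrow> x \<otimes> a \<otimes> a = x"
  using a by (simp add: m_assoc)

lemma mult_ccc: "x \<in> carrier G \<Longrightarrow> x \<otimes> c \<otimes> c \<otimes> c = x"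
  using c by (metis m_assoc m_closed r_one)

lemma a_not_c: "a \<noteq> c" "a \<noteq> c \<otimes> c"
proof -
  show "a \<noteq> c" using a c by (metis l_one)
  show "a \<noteq> c \<otimes> c"
  proof
    assume eq: "a = c \<otimes> c"
    have "\<one> = (c \<otimes> c) \<otimes> (c \<otimes> c)" using a eq by simp
    also have "\<dots> = c \<otimes> c \<otimes> c \<otimes> c" using c by (simp add: m_assoc)
    also have "\<dots> = c" using c by simp
    finally show False using c by simp
  qed
qed

definition tri :: "'a \<Rightarrow> 'a set" where
  "tri x = {x, x \<otimes> c, x \<otimes> c \<otimes> c}"

definition edge :: "'a \<Rightarrow> 'a set" where
  "edge x = {x, x \<otimes> a}"

lemma tri_mult_c: "x \<in> carrier G \<Longrightarrow> tri (x \<otimes> c) = tri x"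
  by (auto simp: tri_def mult_ccc)

lemma edge_mult_a: "x \<in> carrier G \<Longrightarrow> edge (x \<otimes> a) = edge x"
  by (auto simp: edge_def mult_aa)

lemma tri_subset: "x \<in> carrier G \<Longrightarrow> tri x \<subseteq> carrier G"
  using c by (auto simp: tri_def)

lemma edge_subset: "x \<in> carrier G \<Longrightarrow> edge x \<subseteq> carrier G"
  using a by (auto simp: edge_def)

lemma self_in_tri: "x \<in> tri x"
  by (simp add: tri_def)

lemma tri_eq: "x \<in> carrier G \<Longrightarrow> y \<in> tri x \<Longrightarrow> tri y = tri x"
  using c by (auto simp: tri_def mult_ccc)

lemma tri_eq_iff: "x \<in> carrier G \<Longrightarrow> y \<in> carrier G \<Longrightarrow> tri y = tri x \<longleftrightarrow> y \<in> tri x"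
  using tri_eq self_in_tri by metis

lemma tri_mult_a: 
  assumes "x \<in> carrier G" shows "tri (x \<otimes> a) \<noteq> tri x"
proof
  assume "tri (x \<otimes> a) = tri x"
  then have "x \<otimes> a \<in> tri x" using self_in_tri by metis
  then have "x \<otimes> a = x \<otimes> \<one> \<or> x \<otimes> a = x \<otimes> c \<or> x \<otimes> a = x \<otimes> (c \<otimes> c)"
    using assms c unfolding tri_def by (simp add: m_assoc)
  then show False using assms a c a_not_c by simp
qed

lemma mult_a_neq: "x \<in> carrier G \<Longrightarrow> x \<otimes> a \<noteq> x"
  using tri_mult_a by metis

lemma c_distinct:
  assumes "x \<in> carrier G"
  shows "x \<otimes> c \<noteq> x" "x \<otimes> c \<otimes> c \<noteq> x" "x \<otimes> c \<otimes> c \<noteq> x \<otimes> c"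
proof -
  show 1: "x \<otimes> c \<noteq> x" using assms c by simp
  show "x \<otimes> c \<otimes> c \<noteq> x" using assms mult_ccc 1 by metis
  show "x \<otimes> c \<otimes> c \<noteq> x \<otimes> c" using assms c 1 by (metis m_closed right_cancel)
qed

lemma card_tri: "x \<in> carrier G \<Longrightarrow> card (tri x) = 3"
  using c_distinct[of x] by (auto simp: tri_def card_insert_if)

lemma card_edge: "x \<in> carrier G \<Longrightarrow> card (edge x) = 2"
  using mult_a_neq[of x] by (auto simp: edge_def card_insert_if)

lemma card_image_edge:
  assumes A: "A \<subseteq> carrier G" "\<And>x. x \<in> A \<Longrightarrow> x \<otimes> a \<in> A"
  shows "card A = 2 * card (edge ` A)"
proof -
  have "partition_on A (edge ` A)"
  proof (rule partition_onI)
    show "\<Union>(edge ` A) = A" using A by (auto simp: edge_def)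
    show "{} \<notin> edge ` A" by (auto simp: edge_def)
    fix p q assume "p \<in> edge ` A" "q \<in> edge ` A" "p \<noteq> q"
    then show "disjnt p q" using A by (auto simp: disjnt_def edge_def mult_aa subset_iff) (metis mult_aa)+
  qed
  then have "card A = (\<Sum>e\<in>edge ` A. card e)" by (rule product_partition) (auto simp: edge_def)
  also have "\<dots> = (\<Sum>e\<in>edge ` A. 2)" using card_edge A by (intro sum.cong) auto
  finally show ?thesis by simp
qed

lemma card_image_tri:
  assumes A: "A \<subseteq> carrier G" "\<And>x. x \<in> A \<Longrightarrow> x \<otimes> c \<in> A"
  shows "card A = 3 * card (tri ` A)"
proof -
  have "partition_on A (tri ` A)"
  proof (rule partition_onI)
    show "\<Union>(tri ` A) = A" using A by (auto simp: tri_def)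
    show "{} \<notin> tri ` A" by (auto simp: tri_def)
    fix p q assume pq: "p \<in> tri ` A" "q \<in> tri ` A" "p \<noteq> q"
    then obtain x y where xy: "x \<in> A" "p = tri x" "y \<in> A" "q = tri y" by auto
    show "disjnt p q"
    proof (rule ccontr)
      assume "\<not> disjnt p q"
      then obtain z where "z \<in> tri x" "z \<in> tri y" using xy by (auto simp: disjnt_def)
      then show False using tri_eq[of x z] tri_eq[of y z] xy pq A by auto
    qed
  qed
  then have "card A = (\<Sum>e\<in>tri ` A. card e)" by (rule product_partition) (auto simp: tri_def)
  also have "\<dots> = (\<Sum>e\<in>tri ` A. 3)" using card_tri A by (intro sum.cong) auto
  finally show ?thesis by simp
qed

text \<open>An element \<open>x\<close> stands for the dart from \<open>tri x\<close> to
  \<open>tri (x \<otimes> a)\<close>. For a union of cosets this is its edge cut, each edge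
  represented by its inner end.\<close>

definition bdry :: "'a set \<Rightarrow> 'a set" where
  "bdry Y = {x \<in> Y. x \<otimes> a \<notin> Y}"

text \<open>A set of hexagons is represented by the union of its cosets, so that left translations
  and cuts are handled within \<open>G\<close>.\<close>

definition cinv :: "'a set \<Rightarrow> bool" where
  "cinv Y \<longleftrightarrow> Y \<subseteq> carrier G \<and> (\<forall>x\<in>Y. x \<otimes> c \<in> Y)"

lemma cinv_subset: "cinv Y \<Longrightarrow> Y \<subseteq> carrier G"
  by (simp add: cinv_def)

lemma finite_sub: "Y \<subseteq> carrier G \<Longrightarrow> finite Y"
  using fin finite_subset by blast

lemma cinv_Int: "cinv Y \<Longrightarrow> cinv Z \<Longrightarrow> cinv (Y \<inter> Z)"
  and cinv_Un: "cinv Y \<Longrightarrow> cinv Z \<Longrightarrow> cinv (Y \<union> Z)"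
  by (auto simp: cinv_def)

lemma cinv_compl: 
  assumes "cinv Y" shows "cinv (carrier G - Y)"
proof -
  have "x \<in> Y" if "x \<otimes> c \<in> Y" "x \<in> carrier G" for x
    using that assms mult_ccc unfolding cinv_def by metis
  then show ?thesis using c by (auto simp: cinv_def)
qed

lemma card_bdry_compl:
  assumes "Y \<subseteq> carrier G"
  shows "card (bdry (carrier G - Y)) = card (bdry Y)"
proof (rule bij_betw_same_card)
  show "bij_betw (\<lambda>x. x \<otimes> a) (bdry (carrier G - Y)) (bdry Y)"
    by (rule bij_betw_byWitness[where f' = "\<lambda>x. x \<otimes> a"]) (use assms a in \<open>auto simp: bdry_def mult_aa subset_iff\<close>)
qed

lemma card_bdry_submodular:
  assumes "Y \<subseteq> carrier G" "Z \<subseteq> carrier G"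
  shows "card (bdry (Y \<inter> Z)) + card (bdry (Y \<union> Z)) \<le> card (bdry Y) + card (bdry Z)"
proof -
  have f: "finite (bdry A)" if "A \<subseteq> carrier G" for A
    using finite_sub[OF that] by (simp add: bdry_def)
  have "card (bdry (Y \<inter> Z)) + card (bdry (Y \<union> Z)) =
      card (bdry (Y \<inter> Z) \<union> bdry (Y \<union> Z)) + card (bdry (Y \<inter> Z) \<inter> bdry (Y \<union> Z))"
    using assms by (intro card_Un_Int f) auto
  also have "\<dots> \<le> card (bdry Y \<union> bdry Z) + card (bdry Y \<inter> bdry Z)"
    using f assms by (intro add_mono card_mono) (auto simp: bdry_def)
  also have "\<dots> = card (bdry Y) + card (bdry Z)"
    using assms by (intro card_Un_Int[symmetric] f)
  finally show ?thesis .
qed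

lemma card_bdry_parity:
  assumes "Y \<subseteq> carrier G"
  shows "card Y = card (bdry Y) + 2 * card (edge ` {x \<in> Y. x \<otimes> a \<in> Y})"
proof -
  have "card {x \<in> Y. x \<otimes> a \<in> Y} = 2 * card (edge ` {x \<in> Y. x \<otimes> a \<in> Y})"
    by (rule card_image_edge) (use assms mult_aa in auto)
  moreover have "card Y = card (bdry Y) + card {x \<in> Y. x \<otimes> a \<in> Y}"
  proof -
    have "Y = bdry Y \<union> {x \<in> Y. x \<otimes> a \<in> Y}" "bdry Y \<inter> {x \<in> Y. x \<otimes> a \<in> Y} = {}" by (auto simp: bdry_def)
    then show ?thesis using finite_sub[OF assms] by (metis card_Un_disjoint finite_Un)
  qed
  ultimately show ?thesis by simp
qed

lemma bdry_nonempty: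
  assumes "cinv Y" "Y \<noteq> {}" "Y \<noteq> carrier G"
  shows "bdry Y \<noteq> {}"
  using gen[of Y] assms by (auto simp: cinv_def bdry_def)

text \<open>Left translations act transitively on the darts \<open>(x, x \<otimes> a)\<close>, so an inner dart of
  \<open>Y\<close> can be moved to a boundary dart.\<close>

lemma crossing_translate:
  assumes Y: "cinv Y" "Y \<noteq> {}" "card (bdry Y) < card Y" "2 * card Y \<le> card (carrier G)"
  shows "\<exists>Z. cinv Z \<and> card Z = card Y \<and> card (bdry Z) = card (bdry Y) \<and>
    Y \<inter> Z \<noteq> {} \<and> Y \<noteq> Z \<and> Y \<union> Z \<noteq> carrier G"
proof -
  have sub: "Y \<subseteq> carrier G" and fY: "finite Y" using Y finite_sub by (auto simp: cinv_def)
  have "card Y > 0" using Y fY by (simp add: card_gt_0_iff)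
  then have "Y \<noteq> carrier G" using Y(4) by auto
  then obtain z where z: "z \<in> Y" "z \<otimes> a \<notin> Y" using bdry_nonempty Y by (auto simp: bdry_def)
  have "bdry Y \<noteq> Y" using Y(3) by auto
  then obtain y where y: "y \<in> Y" "y \<otimes> a \<in> Y" by (auto simp: bdry_def)
  have yz: "y \<in> carrier G" "z \<in> carrier G" using y z sub by auto
  \<comment> \<open>Translation by \<open>g\<close> takes the inner dart at \<open>y\<close> to the
    boundary dart at \<open>z\<close>, so \<open>z \<otimes> a\<close> lies in \<open>Z\<close> but
    not in \<open>Y\<close>.\<close>
  define g where "g = z \<otimes> inv y"
  have g: "g \<in> carrier G" using yz by (simp add: g_def)
  define Z where "Z = (\<lambda>x. g \<otimes> x) ` Y"
  have inj: "inj_on (\<lambda>x. g \<otimes> x) (carrier G)" using g by (auto simp: inj_on_def)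
  have mem: "g \<otimes> x \<in> Z \<longleftrightarrow> x \<in> Y" if "x \<in> carrier G" for x
    using that inj sub by (auto simp: Z_def inj_on_def)
  have gy: "g \<otimes> y = z" using yz by (simp add: g_def m_assoc)
  have "cinv Z" using Y(1) g c by (auto simp: cinv_def Z_def m_assoc)
  moreover have cZ: "card Z = card Y"
    unfolding Z_def using inj sub by (intro card_image) (rule inj_on_subset)
  moreover have "card (bdry Z) = card (bdry Y)"
  proof -
    have "g \<otimes> x \<otimes> a \<in> Z \<longleftrightarrow> x \<otimes> a \<in> Y" if "x \<in> Y" for x
      using mem[of "x \<otimes> a"] that sub g a by (simp add: m_assoc subset_iff)
    then have "bdry Z = (\<lambda>x. g \<otimes> x) ` bdry Y" by (auto simp: bdry_def Z_def)
    moreover have "inj_on (\<lambda>x. g \<otimes> x) (bdry Y)"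
      by (rule inj_on_subset[OF inj]) (use sub in \<open>auto simp: bdry_def\<close>)
    ultimately show ?thesis by (simp add: card_image)
  qed
  moreover have zZ: "z \<in> Y \<inter> Z" using mem[OF yz(1)] y z gy by simp
  moreover have "z \<otimes> a \<in> Z" using mem[of "y \<otimes> a"] y yz g a gy by (simp flip: m_assoc)
  then have "Y \<noteq> Z" using z by auto
  moreover have "Y \<union> Z \<noteq> carrier G"
  proof
    assume eq: "Y \<union> Z = carrier G"
    have fZ: "finite Z" using fY by (simp add: Z_def)
    have "card Y + card Z = card (Y \<union> Z) + card (Y \<inter> Z)" by (rule card_Un_Int[OF fY fZ])
    moreover have "card (Y \<inter> Z) > 0" using zZ fY by (auto simp: card_gt_0_iff)
    ultimately show False using eq cZ Y(4) by simp
  qed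
  ultimately show ?thesis by blast
qed

lemma card_cinv: "cinv Y \<Longrightarrow> card Y = 3 * card (tri ` Y)"
  using card_image_tri by (simp add: cinv_def)

lemma card_cinv_ge_3:
  assumes "cinv Y" "Y \<noteq> {}" shows "card Y \<ge> 3"
proof -
  have "card Y > 0" using assms finite_sub by (auto simp: cinv_def card_gt_0_iff)
  then show ?thesis using card_cinv[OF assms(1)] by simp
qed

lemma card_compl: "Y \<subseteq> carrier G \<Longrightarrow> card (carrier G - Y) + card Y = card (carrier G)"
  using finite_sub[of Y] fin by (metis card_Diff_subset card_mono le_add_diff_inverse2)

text \<open>An atom argument: \<open>A\<close> has least boundary and, subject to that, least size,
  hence at most half of the group. A boundary below 3 is smaller than \<open>A\<close>, so a
  translate \<open>Z\<close> crosses \<open>A\<close>. By submodularity \<open>A \<inter> Z\<close>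
  again has least boundary, hence equals \<open>A\<close>, and sizes force
  \<open>A = Z\<close>.\<close>

lemma card_bdry_ge_3:
  assumes "cinv Y" "Y \<noteq> {}" "Y \<noteq> carrier G"
  shows "card (bdry Y) \<ge> 3"
proof (rule ccontr)
  assume less: "\<not> ?thesis"
  define P where "P A \<longleftrightarrow> cinv A \<and> A \<noteq> {} \<and> A \<noteq> carrier G" for A
  obtain A where A: "P A" and min1: "\<And>B. P B \<Longrightarrow> card (bdry A) \<le> card (bdry B)"
    and min2: "\<And>B. P B \<Longrightarrow> card (bdry B) = card (bdry A) \<Longrightarrow> card A \<le> card B"
  proof -
    obtain A0 where A0: "P A0" "\<And>B. P B \<Longrightarrow> card (bdry A0) \<le> card (bdry B)"
      using ex_has_least_nat[of P Y "\<lambda>B. card (bdry B)"] assms by (auto simp: P_def)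
    obtain A where "P A \<and> card (bdry A) = card (bdry A0)"
      "\<And>B. P B \<and> card (bdry B) = card (bdry A0) \<Longrightarrow> card A \<le> card B"
      using ex_has_least_nat[of "\<lambda>B. P B \<and> card (bdry B) = card (bdry A0)" A0 card] A0(1) by blast
    then show thesis using that[of A] A0(2) by simp
  qed
  have d: "card (bdry A) < 3" using min1[of Y] assms less by (auto simp: P_def)
  have As: "A \<subseteq> carrier G" "cinv A" "A \<noteq> {}" using A by (auto simp: P_def cinv_def)
  have "P (carrier G - A)" using A cinv_compl[of A] by (auto simp: P_def cinv_def)
  then have "card A \<le> card (carrier G - A)" using min2 card_bdry_compl[OF As(1)] by blast
  then have "2 * card A \<le> card (carrier G)" using card_compl[OF As(1)] by simp
  moreover have "card (bdry A) < card A" using d card_cinv_ge_3[OF As(2,3)] by simp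
  ultimately obtain Z where Z: "cinv Z" "card Z = card A" "card (bdry Z) = card (bdry A)"
      "A \<inter> Z \<noteq> {}" "A \<noteq> Z" "A \<union> Z \<noteq> carrier G"
    using crossing_translate[OF As(2,3)] by blast
  have "A \<inter> Z \<noteq> carrier G" using A As(1) unfolding P_def by blast
  then have PI: "P (A \<inter> Z)" "P (A \<union> Z)"
    using As(3) Z(4,6) cinv_Int[OF As(2) Z(1)] cinv_Un[OF As(2) Z(1)] by (simp_all add: P_def)
  have "card (bdry (A \<inter> Z)) + card (bdry (A \<union> Z)) \<le> card (bdry A) + card (bdry Z)"
    by (rule card_bdry_submodular[OF As(1) cinv_subset[OF Z(1)]])
  then have "card (bdry (A \<inter> Z)) = card (bdry A)"
    using min1[OF PI(1)] min1[OF PI(2)] Z(3) by simp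
  then have "card A \<le> card (A \<inter> Z)" using min2[OF PI(1)] by simp
  then have "A \<inter> Z = A" using finite_sub[OF As(1)] by (intro card_seteq) auto
  then have "A = Z" using Z(2) finite_sub[OF cinv_subset[OF Z(1)]] by (intro card_subset_eq) auto
  then show False using Z by simp
qed

text \<open>The atom argument among nontrivial cuts of size 3 shows only that a translate meets
  \<open>A\<close> in a single coset. Applied also to the complement of the translate, it splits
  \<open>A\<close> into two cosets; but a set of 6 elements has an even boundary.\<close>

lemma card_bdry_3:
  assumes "cinv Y" "card (bdry Y) = 3"
  shows "card Y = 3 \<or> card (carrier G - Y) = 3"
proof (rule ccontr)
  assume neg: "\<not> ?thesis"
  \<comment> \<open>Both sides are required to be nontrivial, which makes \<open>P\<close> invariant
    under complement, so the least \<open>A\<close> fills at most half of the group.\<close>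
  define P where "P A \<longleftrightarrow> cinv A \<and> card (bdry A) = 3 \<and> card A \<noteq> 3 \<and> card (carrier G - A) \<noteq> 3" for A
  obtain A where A: "P A" and minA: "\<And>B. P B \<Longrightarrow> card A \<le> card B"
    using ex_has_least_nat[of P Y card] assms neg by (auto simp: P_def)
  have As: "A \<subseteq> carrier G" "cinv A" "card (bdry A) = 3" "card A \<noteq> 3" "card (carrier G - A) \<noteq> 3"
    using A by (auto simp: P_def cinv_def)
  have ne: "A \<noteq> {}" using As(3) by (auto simp: bdry_def)
  have "carrier G - (carrier G - A) = A" using As by auto
  then have "P (carrier G - A)"
    using As cinv_compl[OF As(2)] card_bdry_compl[OF As(1)] by (simp add: P_def)
  then have "card A \<le> card (carrier G - A)" by (rule minA)
  then have half: "2 * card A \<le> card (carrier G)" using card_compl[OF As(1)] by simp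
  have c4: "card A > 3" using card_cinv_ge_3[OF As(2) ne] As(4) by simp
  have c4': "card (carrier G - A) > 3" using c4 \<open>card A \<le> card (carrier G - A)\<close> by simp
  obtain Z where Z: "cinv Z" "card Z = card A" "card (bdry Z) = 3"
      "A \<inter> Z \<noteq> {}" "A \<noteq> Z" "A \<union> Z \<noteq> carrier G"
    using crossing_translate[OF As(2) ne _ half] c4 As(3) by metis
  have fA: "finite A" "finite Z" using finite_sub As Z cinv_subset by auto
  have notsub: "\<not> A \<subseteq> Z" "\<not> Z \<subseteq> A" using card_subset_eq fA Z(2,5) by metis+
  \<comment> \<open>By minimality of \<open>A\<close> the smaller set \<open>A \<inter> B\<close> is
    a trivial cut. Its complement contains that of \<open>A\<close> and is too large to be the
    trivial side.\<close>
  have key: "card (A \<inter> B) = 3" if B: "cinv B" "card (bdry B) = 3" "A \<inter> B \<noteq> {}" "A \<union> B \<noteq> carrier G"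
      "\<not> A \<subseteq> B" for B
  proof -
    have Bs: "B \<subseteq> carrier G" using B cinv_subset by auto
    have "card (bdry (A \<inter> B)) + card (bdry (A \<union> B)) \<le> card (bdry A) + card (bdry B)"
      by (rule card_bdry_submodular[OF As(1) Bs])
    moreover have "card (bdry (A \<inter> B)) \<ge> 3"
      using B As by (intro card_bdry_ge_3 cinv_Int) blast+
    moreover have "card (bdry (A \<union> B)) \<ge> 3"
      using B As ne by (intro card_bdry_ge_3 cinv_Un) blast+
    ultimately have d: "card (bdry (A \<inter> B)) = 3" using As(3) B(2) by simp
    have lt: "card (A \<inter> B) < card A" using B(5) fA by (intro psubset_card_mono) auto
    then have "\<not> P (A \<inter> B)" using minA by (meson not_less)
    then have "card (A \<inter> B) = 3 \<or> card (carrier G - A \<inter> B) = 3"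
      using d cinv_Int[OF As(2) B(1)] by (auto simp: P_def)
    moreover have "card (carrier G - A) \<le> card (carrier G - A \<inter> B)"
      using fin by (intro card_mono) auto
    ultimately show ?thesis using c4' by auto
  qed
  have "card (A \<inter> Z) = 3" by (rule key) (use Z notsub in auto)
  moreover have "card (A \<inter> (carrier G - Z)) = 3"
  proof (rule key)
    show "cinv (carrier G - Z)" by (rule cinv_compl[OF Z(1)])
    show "card (bdry (carrier G - Z)) = 3" using card_bdry_compl[OF cinv_subset[OF Z(1)]] Z(3) by simp
    show "A \<inter> (carrier G - Z) \<noteq> {}" using notsub As(1) by auto
    show "A \<union> (carrier G - Z) \<noteq> carrier G" using notsub cinv_subset[OF Z(1)] by auto
    show "\<not> A \<subseteq> carrier G - Z" using Z(4) by auto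
  qed
  moreover have "card A = card (A \<inter> Z) + card (A \<inter> (carrier G - Z))"
  proof -
    have "A \<inter> (carrier G - Z) = A - Z" using As by auto
    then show ?thesis using card_Int_Diff[OF fA(1), of Z] by simp
  qed
  ultimately have "card A = 6" by simp
  then show False using card_bdry_parity[OF As(1)] As(3) by presburger
qed

end

subsection \<open>Boundary cycles of trees of hexagons\<close>

text \<open>The degrees sum to \<open>2 * card S - 2\<close>, so some vertex has degree below 2.
  Degree 0 would leave too many edges on the other vertices.\<close>

lemma sparse_leaf:
  assumes G: "multigraph ends F S" and cnt: "card F + 1 = card S" and sp: "sparse ends F S"
    and S2: "card S \<ge> 2"
  shows "\<exists>v\<in>S. \<exists>e\<in>F. {f \<in> F. v \<in> ends f} = {e} \<and> card (induced ends F (S - {v})) + 1 = card (S - {v})"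
proof -
  have fS: "finite S" and fF: "finite F" using G by (auto simp: multigraph_def)
  have "\<exists>v\<in>S. card {f \<in> F. v \<in> ends f} < 2"
  proof (rule ccontr)
    assume "\<not> ?thesis"
    then have "(\<Sum>v\<in>S. 2) \<le> (\<Sum>v\<in>S. card {f \<in> F. v \<in> ends f})" by (intro sum_mono) auto
    then show False using handshake[OF G] cnt by simp
  qed
  then obtain v where v: "v \<in> S" "card {f \<in> F. v \<in> ends f} < 2" by auto
  have cS: "card (S - {v}) + 1 = card S" using v fS by (metis Suc_eq_plus1 card_Suc_Diff1)
  have "induced ends F (S - {v}) = F - {f \<in> F. v \<in> ends f}"
    using G by (auto simp: induced_def multigraph_def)
  moreover have "card (F - {f \<in> F. v \<in> ends f}) + card {f \<in> F. v \<in> ends f} = card F"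
    using fF by (metis (no_types, lifting) card_Diff_subset card_mono finite_subset le_add_diff_inverse2 mem_Collect_eq subsetI)
  ultimately have split: "card (induced ends F (S - {v})) + card {f \<in> F. v \<in> ends f} = card F" by simp
  have "S - {v} \<noteq> {}" using cS S2 by (metis card.empty add_0 not_numeral_le_zero one_add_one add_le_cancel_right le_zero_eq one_neq_zero)
  then have "card (induced ends F (S - {v})) < card (S - {v})"
    using sp by (simp add: sparse_def Diff_subset)
  then have one: "card {f \<in> F. v \<in> ends f} = 1" using split v cS cnt by linarith
  then obtain e where "{f \<in> F. v \<in> ends f} = {e}" by (auto simp: card_1_singleton_iff)
  then show ?thesis using v split one cS cnt by (intro bexI[of _ v] bexI[of _ e]) auto
qed

section \<open>Cycles as lists up to rotation\<close>

fun path_pairs :: "'a list \<Rightarrow> ('a \<times> 'a) set" where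
  "path_pairs (x # y # zs) = insert (x, y) (path_pairs (y # zs))" |
  "path_pairs _ = {}"

definition cycle_pairs :: "'a list \<Rightarrow> ('a \<times> 'a) set" where
  "cycle_pairs xs = insert (last xs, hd xs) (path_pairs xs)"

lemma path_pairs_append:
  "xs \<noteq> [] \<Longrightarrow> ys \<noteq> [] \<Longrightarrow> path_pairs (xs @ ys) = path_pairs xs \<union> path_pairs ys \<union> {(last xs, hd ys)}"
proof (induction xs rule: path_pairs.induct)
  case ("2_2" v)
  then show ?case by (cases ys) auto
qed auto

lemma cycle_pairs_rotate:
  "xs \<noteq> [] \<Longrightarrow> ys \<noteq> [] \<Longrightarrow> cycle_pairs (xs @ ys) = cycle_pairs (ys @ xs)"
  by (auto simp: cycle_pairs_def path_pairs_append)

lemma path_pairs_split: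
  "(x, y) \<in> path_pairs zs \<Longrightarrow> \<exists>us vs. zs = us @ vs \<and> us \<noteq> [] \<and> vs \<noteq> [] \<and> last us = x \<and> hd vs = y"
proof (induction zs rule: path_pairs.induct)
  case (1 u v zs)
  show ?case
  proof (cases "(x, y) = (u, v)")
    case True
    then show ?thesis by (intro exI[of _ "[u]"] exI[of _ "v # zs"]) simp
  next
    case False
    then obtain us vs where "v # zs = us @ vs" "us \<noteq> []" "vs \<noteq> []" "last us = x" "hd vs = y"
      using 1 by auto
    then show ?thesis by (intro exI[of _ "u # us"] exI[of _ vs]) auto
  qed
qed auto

text \<open>Opens the cycle at a chosen step, which can then be replaced by appending a
  detour.\<close>

lemma cycle_pairs_rotate_to:
  assumes "(x, y) \<in> cycle_pairs zs" "zs \<noteq> []" "distinct zs"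
  shows "\<exists>ws. ws \<noteq> [] \<and> distinct ws \<and> set ws = set zs \<and> length ws = length zs \<and>
    cycle_pairs ws = cycle_pairs zs \<and> last ws = x \<and> hd ws = y"
proof (cases "(x, y) = (last zs, hd zs)")
  case True
  then show ?thesis using assms by auto
next
  case False
  then have "(x, y) \<in> path_pairs zs" using assms(1) by (auto simp: cycle_pairs_def)
  then obtain us vs where uv: "zs = us @ vs" "us \<noteq> []" "vs \<noteq> []" "last us = x" "hd vs = y"
    using path_pairs_split by metis
  then have "cycle_pairs (vs @ us) = cycle_pairs zs" using cycle_pairs_rotate by metis
  then show ?thesis using uv assms by (intro exI[of _ "vs @ us"]) auto
qed

section \<open>The hexagon graph and the boundary cycles of its trees\<close>

context hexagonal
begin

definition hexV :: "'a set set" where "hexV = tri ` carrier G"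
text \<open>Edges are kept as pairs of group elements so that parallel ones stay distinct: for $|G|
  = 6$ the graph consists of two vertices and three parallel edges.\<close>

definition hexE :: "'a set set" where "hexE = edge ` carrier G"
definition hends :: "'a set \<Rightarrow> 'a set set" where "hends e = tri ` e"

lemma hends_edge: "hends (edge x) = {tri x, tri (x \<otimes> a)}"
  by (auto simp: hends_def edge_def)

lemma multigraph_hex: "multigraph hends hexE hexV"
  unfolding multigraph_def
proof (intro conjI ballI)
  show "finite hexV" "finite hexE" using fin by (auto simp: hexV_def hexE_def)
  fix e assume "e \<in> hexE"
  then obtain x where x: "x \<in> carrier G" "e = edge x" by (auto simp: hexE_def)
  show "hends e \<subseteq> hexV" using x edge_subset by (auto simp: hends_def hexV_def)
  show "card (hends e) = 2" using x tri_mult_a[OF x(1)] by (auto simp: hends_edge card_2_iff)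
qed

definition cover :: "'a set set \<Rightarrow> 'a set" where
  "cover X = {x \<in> carrier G. tri x \<in> X}"

lemma cinv_cover: "cinv (cover X)"
  using c by (auto simp: cinv_def cover_def tri_mult_c)

lemma tri_image_cover: "X \<subseteq> hexV \<Longrightarrow> tri ` cover X = X"
  by (auto simp: cover_def hexV_def)

lemma card_cover: "X \<subseteq> hexV \<Longrightarrow> card (cover X) = 3 * card X"
  using card_cinv[OF cinv_cover, of X] tri_image_cover by simp

lemma card_carrier: "card (carrier G) = 3 * card hexV"
proof -
  have "cover hexV = carrier G" by (auto simp: cover_def hexV_def)
  then show ?thesis using card_cover[of hexV] by simp
qed

lemma induced_hexE: "induced hends hexE X = edge ` {x \<in> cover X. x \<otimes> a \<in> cover X}"
  using a by (auto simp: induced_def hexE_def cover_def hends_edge)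

text \<open>Of the three darts at each vertex of \<open>X\<close>, those on inner edges come in
  pairs and the others form the boundary.\<close>

lemma card_bdry_cover:
  assumes "X \<subseteq> hexV"
  shows "3 * card X = card (bdry (cover X)) + 2 * card (induced hends hexE X)"
  using card_bdry_parity[OF cinv_subset[OF cinv_cover]] card_cover[OF assms]
  by (simp add: induced_hexE)

lemma hex_cyclically_connected: "cyclically_connected_cubic hends hexE hexV"
proof
  show "multigraph hends hexE hexV" by (rule multigraph_hex)
  show "hexV \<noteq> {}" by (auto simp: hexV_def)
  show "card {e \<in> hexE. v \<in> hends e} = 3" if v: "v \<in> hexV" for v
  proof -
    obtain x where x: "x \<in> carrier G" "v = tri x" using v by (auto simp: hexV_def)
    have "{e \<in> hexE. v \<in> hends e} = edge ` tri x"
    proof (intro equalityI subsetI)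
      fix e assume "e \<in> {e \<in> hexE. v \<in> hends e}"
      then obtain y where y: "y \<in> carrier G" "e = edge y" "v \<in> hends (edge y)" by (auto simp: hexE_def)
      have ya: "y \<otimes> a \<in> carrier G" using y a by simp
      have "tri y = tri x \<or> tri (y \<otimes> a) = tri x" using y x by (auto simp: hends_edge)
      then have "y \<in> tri x \<or> y \<otimes> a \<in> tri x" using tri_eq_iff[OF x(1)] y(1) ya by blast
      then show "e \<in> edge ` tri x" using y edge_mult_a by blast
    next
      fix e assume "e \<in> edge ` tri x"
      then obtain y where y: "y \<in> tri x" "e = edge y" by auto
      then have "y \<in> carrier G" "tri y = tri x" using tri_subset[OF x(1)] x(2) tri_eq[OF x(1) y(1)] by auto
      then show "e \<in> {e \<in> hexE. v \<in> hends e}" using y x by (auto simp: hexE_def hends_edge)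
    qed
    moreover have "inj_on edge (tri x)"
    proof (rule inj_onI)
      fix y z assume yz: "y \<in> tri x" "z \<in> tri x" "edge y = edge z"
      have "z \<noteq> y \<otimes> a" using yz(1) tri_mult_a[of y] tri_eq[OF x(1) yz(1)] tri_eq[OF x(1) yz(2)] tri_subset[OF x(1)] by auto
      moreover have "z \<in> edge y" using yz by (simp add: edge_def)
      ultimately show "y = z" by (auto simp: edge_def)
    qed
    ultimately show ?thesis using card_image card_tri x by metis
  qed
next
  fix X assume X: "X \<subset> hexV" "X \<noteq> {}"
  then have sub: "X \<subseteq> hexV" by auto
  have "tri ` cover X \<noteq> {}" "tri ` cover X \<noteq> tri ` carrier G"
    using X tri_image_cover[OF sub] by (auto simp: hexV_def)
  then have "card (bdry (cover X)) \<ge> 3" by (intro card_bdry_ge_3 cinv_cover) auto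
  then show "2 * card (induced hends hexE X) + 3 \<le> 3 * card X"
    using card_bdry_cover[OF sub] by simp
next
  fix X assume X: "X \<subset> hexV" "2 * card (induced hends hexE X) + 3 = 3 * card X"
  then have sub: "X \<subseteq> hexV" by auto
  have "card (bdry (cover X)) = 3" using X card_bdry_cover[OF sub] by simp
  then have "card (cover X) = 3 \<or> card (carrier G - cover X) = 3"
    by (rule card_bdry_3[OF cinv_cover])
  moreover have "carrier G - cover X = cover (hexV - X)" by (auto simp: cover_def hexV_def)
  ultimately show "card X = 1 \<or> card (hexV - X) = 1"
    using card_cover[OF sub] card_cover[of "hexV - X"] by auto
qed

text \<open>The vertex set of the union of the hexagons in \<open>S\<close>: the hexagon of
  \<open>tri p\<close> consists of the elements \<open>y\<close> and \<open>y \<otimes> a\<close>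
  with \<open>y\<close> in \<open>tri p\<close>.\<close>

definition around :: "'a set set \<Rightarrow> 'a set" where
  "around S = {x \<in> carrier G. tri x \<in> S \<or> tri (x \<otimes> a) \<in> S}"

text \<open>The steps of the cycle along \<open>b = c \<otimes> a\<close> are sides of hexagons in \<open>S\<close>; along \<open>a\<close> it always
  enters the cosets in \<open>S\<close>. This orientation is the invariant that lets a new hexagon be spliced in.\<close>

definition boundary_cycle :: "'a set set \<Rightarrow> 'a list \<Rightarrow> bool" where
  "boundary_cycle S xs \<longleftrightarrow> distinct xs \<and> set xs = around S \<and> length xs = 4 * card S + 2 \<and>
     (\<forall>(x, y) \<in> cycle_pairs xs. y = x \<otimes> a \<or> y = x \<otimes> (c \<otimes> a)) \<and>
     (\<forall>x\<in>carrier G. tri x \<notin> S \<longrightarrow> tri (x \<otimes> a) \<in> S \<longrightarrow> (x, x \<otimes> a) \<in> cycle_pairs xs)"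

lemma mult_a_in_tri_iff:
  assumes "x \<in> carrier G" "p \<in> carrier G"
  shows "tri (x \<otimes> a) = tri p \<longleftrightarrow> x \<in> {p \<otimes> a, p \<otimes> c \<otimes> a, p \<otimes> c \<otimes> c \<otimes> a}"
proof -
  have "tri (x \<otimes> a) = tri p \<longleftrightarrow> x \<otimes> a \<in> tri p" using assms a by (intro tri_eq_iff) auto
  moreover have "x \<otimes> a = y \<longleftrightarrow> x = y \<otimes> a" if "y \<in> carrier G" for y
    using that assms mult_aa by metis
  ultimately show ?thesis using assms c by (auto simp: tri_def)
qed

lemma boundary_cycle_single:
  assumes p: "p \<in> carrier G"
  shows "\<exists>xs. boundary_cycle {tri p} xs"
proof -
  \<comment> \<open>Steps along \<open>c \<otimes> a\<close> and along \<open>a\<close> alternate;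
    since \<open>c\<close> has order 3 the last of the former ends in \<open>p \<otimes> a\<close>,
    and the closing step is along \<open>a\<close>.\<close>
  let ?xs = "[p, p \<otimes> c \<otimes> a, p \<otimes> c, p \<otimes> c \<otimes> c \<otimes> a, p \<otimes> c \<otimes> c, p \<otimes> a]"
  have pc: "p \<otimes> c \<in> carrier G" "p \<otimes> c \<otimes> c \<in> carrier G" using p c by auto
  have n: "x \<noteq> y \<otimes> a" if "x \<in> tri p" "y \<in> tri p" for x y
    using tri_eq[OF p that(1)] tri_eq[OF p that(2)] tri_mult_a[of y] tri_subset[OF p] that(2) by auto
  have dis: "distinct ?xs"
    using c_distinct[OF p] n pc p a by (auto simp: tri_def dest: sym)
  have st: "set ?xs = around {tri p}"
  proof (intro equalityI subsetI)
    fix x assume x: "x \<in> set ?xs"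
    then have "x \<in> tri p \<or> x \<in> {p \<otimes> a, p \<otimes> c \<otimes> a, p \<otimes> c \<otimes> c \<otimes> a}" "x \<in> carrier G"
      using pc p a by (auto simp: tri_def)
    then show "x \<in> around {tri p}" using tri_eq[OF p, of x] mult_a_in_tri_iff[OF _ p, of x] by (auto simp: around_def)
  next
    fix x assume x: "x \<in> around {tri p}"
    then have "x \<in> tri p \<or> x \<in> {p \<otimes> a, p \<otimes> c \<otimes> a, p \<otimes> c \<otimes> c \<otimes> a}"
      using tri_eq_iff[OF p, of x] mult_a_in_tri_iff[OF _ p, of x] by (auto simp: around_def)
    then show "x \<in> set ?xs" by (auto simp: tri_def)
  qed
  have "\<forall>(x, y) \<in> cycle_pairs ?xs. y = x \<otimes> a \<or> y = x \<otimes> (c \<otimes> a)"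
    using p a c by (simp add: cycle_pairs_def mult_aa m_assoc[symmetric] mult_ccc)
  moreover have "(x, x \<otimes> a) \<in> cycle_pairs ?xs" if "x \<in> carrier G" "tri (x \<otimes> a) = tri p" for x
    using mult_a_in_tri_iff[OF that(1) p] that p pc by (auto simp: cycle_pairs_def mult_aa)
  ultimately have "boundary_cycle {tri p} ?xs"
    unfolding boundary_cycle_def using dis st by simp
  then show ?thesis by blast
qed

text \<open>Attaching a leaf hexagon replaces the step from \<open>p\<close> to \<open>p \<otimes> a\<close> on the boundary by
  the other five sides of the hexagon.\<close>

lemma boundary_cycle_insert:
  assumes p: "p \<in> carrier G" and S: "finite S" "tri p \<notin> S" "tri (p \<otimes> a) \<in> S"
    and leaf: "tri (p \<otimes> c \<otimes> a) \<notin> S" "tri (p \<otimes> c \<otimes> c \<otimes> a) \<notin> S"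
    and xs: "boundary_cycle S xs"
  shows "\<exists>ys. boundary_cycle (insert (tri p) S) ys"
proof -
  have X: "distinct xs" "set xs = around S" "length xs = 4 * card S + 2"
    "\<forall>(x, y) \<in> cycle_pairs xs. y = x \<otimes> a \<or> y = x \<otimes> (c \<otimes> a)"
    "\<And>x. x \<in> carrier G \<Longrightarrow> tri x \<notin> S \<Longrightarrow> tri (x \<otimes> a) \<in> S \<Longrightarrow> (x, x \<otimes> a) \<in> cycle_pairs xs"
    using xs unfolding boundary_cycle_def by blast+
  have "(p, p \<otimes> a) \<in> cycle_pairs xs" "xs \<noteq> []" using X(3) by (intro X(5) p S, auto)
  then obtain ws where ws: "ws \<noteq> []" "distinct ws" "set ws = around S" "length ws = 4 * card S + 2"
      "cycle_pairs ws = cycle_pairs xs" "last ws = p" "hd ws = p \<otimes> a"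
    using cycle_pairs_rotate_to X(1,2,3) by metis
  let ?zs = "[p \<otimes> c \<otimes> a, p \<otimes> c, p \<otimes> c \<otimes> c \<otimes> a, p \<otimes> c \<otimes> c]"
  have pc: "p \<otimes> c \<in> carrier G" "p \<otimes> c \<otimes> c \<in> carrier G" using p c by auto
  have t: "tri (p \<otimes> c) = tri p" "tri (p \<otimes> c \<otimes> c) = tri p" using tri_mult_c p pc by auto
  have n: "x \<noteq> y \<otimes> a" if "x \<in> tri p" "y \<in> tri p" for x y
    using tri_eq[OF p that(1)] tri_eq[OF p that(2)] tri_mult_a[of y] tri_subset[OF p] that(2) by auto
  have "distinct ?zs" using c_distinct[OF p] n pc p a by (auto simp: tri_def dest: sym)
  \<comment> \<open>The four added vertices are new because neither \<open>tri p\<close> nor the two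
    other neighbours of \<open>tri p\<close> lie in \<open>S\<close>.\<close>
  moreover have "set ws \<inter> set ?zs = {}"
    using ws(3) leaf S t pc by (auto simp: around_def mult_aa)
  ultimately have dis: "distinct (ws @ ?zs)" using ws(2) by auto
  have old: "cycle_pairs xs = insert (p, p \<otimes> a) (path_pairs ws)"
    using ws(5,6,7) by (simp add: cycle_pairs_def)
  have new: "cycle_pairs (ws @ ?zs) = path_pairs ws \<union> {(p, p \<otimes> c \<otimes> a), (p \<otimes> c \<otimes> a, p \<otimes> c),
      (p \<otimes> c, p \<otimes> c \<otimes> c \<otimes> a), (p \<otimes> c \<otimes> c \<otimes> a, p \<otimes> c \<otimes> c), (p \<otimes> c \<otimes> c, p \<otimes> a)}"
    using ws by (auto simp: cycle_pairs_def path_pairs_append)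
  have st: "set (ws @ ?zs) = around (insert (tri p) S)"
  proof (intro equalityI subsetI)
    fix x assume "x \<in> set (ws @ ?zs)"
    then show "x \<in> around (insert (tri p) S)" using ws(3) t pc p a by (auto simp: around_def mult_aa)
  next
    fix x assume x: "x \<in> around (insert (tri p) S)"
    then consider "x \<in> around S" | "x \<in> tri p" | "x \<in> {p \<otimes> a, p \<otimes> c \<otimes> a, p \<otimes> c \<otimes> c \<otimes> a}"
      using tri_eq_iff[OF p, of x] mult_a_in_tri_iff[OF _ p, of x] by (auto simp: around_def)
    then show "x \<in> set (ws @ ?zs)"
    proof cases
      case 2
      have "p \<in> around S" using p S by (simp add: around_def)
      then show ?thesis using 2 ws(3) by (auto simp: tri_def)
    next
      case 3
      have "p \<otimes> a \<in> around S" using p a S by (simp add: around_def)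
      then show ?thesis using 3 ws(3) by auto
    qed (use ws(3) in auto)
  qed
  have "\<forall>(x, y) \<in> cycle_pairs (ws @ ?zs). y = x \<otimes> a \<or> y = x \<otimes> (c \<otimes> a)"
  proof -
    have "\<forall>(x, y) \<in> path_pairs ws. y = x \<otimes> a \<or> y = x \<otimes> (c \<otimes> a)" using X(4) old by auto
    then show ?thesis unfolding new using p a c by (auto simp: mult_aa m_assoc[symmetric] mult_ccc)
  qed
  moreover have "(x, x \<otimes> a) \<in> cycle_pairs (ws @ ?zs)"
    if x: "x \<in> carrier G" "tri x \<notin> insert (tri p) S" "tri (x \<otimes> a) \<in> insert (tri p) S" for x
  proof (cases "tri (x \<otimes> a) = tri p")
    case True
    then have "x \<in> {p \<otimes> c \<otimes> a, p \<otimes> c \<otimes> c \<otimes> a}" using mult_a_in_tri_iff[OF x(1) p] x S by auto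
    then show ?thesis unfolding new using pc by (auto simp: mult_aa)
  next
    case False
    then have "(x, x \<otimes> a) \<in> cycle_pairs xs" using X(5) x by auto
    moreover have "x \<noteq> p" using x by auto
    ultimately show ?thesis unfolding new old by auto
  qed
  moreover have "length (ws @ ?zs) = 4 * card (insert (tri p) S) + 2" using ws S by simp
  ultimately have "boundary_cycle (insert (tri p) S) (ws @ ?zs)"
    unfolding boundary_cycle_def using dis st by blast
  then show ?thesis by blast
qed

lemma boundary_cycle_tree:
  assumes "S \<subseteq> hexV" "S \<noteq> {}" "sparse hends (induced hends hexE S) S"
    and "card (induced hends hexE S) + 1 = card S"
  shows "\<exists>xs. boundary_cycle S xs"
  using assms
proof (induction "card S" arbitrary: S rule: less_induct)
  case less
  have fS: "finite S" using finite_subset[OF less.prems(1)] fin by (simp add: hexV_def)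
  have "card S > 0" using fS less.prems by (simp add: card_gt_0_iff)
  then consider "card S = 1" | "card S \<ge> 2" by linarith
  then show ?case
  proof cases
    case 1
    then obtain v where "S = {v}" using card_1_singletonE by blast
    then obtain p where "p \<in> carrier G" "S = {tri p}" using less.prems(1) by (auto simp: hexV_def)
    then show ?thesis using boundary_cycle_single by blast
  next
    case 2
    let ?F = "induced hends hexE S"
    obtain v e where v: "v \<in> S" "e \<in> ?F" "{f \<in> ?F. v \<in> hends f} = {e}"
        "card (induced hends ?F (S - {v})) + 1 = card (S - {v})"
      using sparse_leaf[OF multigraph_induced[OF multigraph_hex less.prems(1)] less.prems(4,3) 2] by blast
    have ind: "induced hends ?F (S - {v}) = induced hends hexE (S - {v})" by (rule induced_induced) auto
    have "card (S - {v}) < card S" using fS v(1) by (intro psubset_card_mono) auto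
    moreover have "S - {v} \<noteq> {}" using v(4) by (metis card.empty add_is_0 one_neq_zero)
    moreover have "sparse hends (induced hends hexE (S - {v})) (S - {v})"
      unfolding sparse_def
    proof (intro allI impI)
      fix Z assume Z: "Z \<subseteq> S - {v}" "Z \<noteq> {}"
      then have "card (induced hends ?F Z) < card Z"
        using less.prems(3) unfolding sparse_def by blast
      then show "card (induced hends (induced hends hexE (S - {v})) Z) < card Z"
        using Z by (simp add: induced_induced subset_Diff_insert)
    qed
    ultimately obtain xs where xs: "boundary_cycle (S - {v}) xs"
      using less.hyps[of "S - {v}"] less.prems(1) v(4) ind by auto
    obtain y where y: "y \<in> carrier G" "e = edge y" using v(2) by (auto simp: induced_def hexE_def)
    have "v \<in> hends e" using v(3) by blast
    then have "\<exists>p\<in>carrier G. e = edge p \<and> v = tri p"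
      using y a edge_mult_a[of y] by (auto simp: hends_edge) 
    then obtain p where p: "p \<in> carrier G" "e = edge p" "v = tri p" by blast
    have "tri (p \<otimes> a) \<in> S" using v(2) p by (simp add: induced_def hends_edge)
    then have pa: "tri (p \<otimes> a) \<in> S - {v}" using tri_mult_a p by auto
    \<comment> \<open>Another dart from \<open>tri p\<close> into the tree would give a second edge
      at the leaf \<open>v\<close>, even if it were parallel to \<open>e\<close>.\<close>
    have leaf: "tri (q \<otimes> a) \<notin> S - {v}" if q: "q \<in> tri p" "q \<noteq> p" for q
    proof
      assume S: "tri (q \<otimes> a) \<in> S - {v}"
      have qG: "q \<in> carrier G" "tri q = tri p" using q tri_subset[OF p(1)] tri_eq[OF p(1)] by auto
      then have "edge q \<in> {f \<in> ?F. v \<in> hends f}"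
        using S p v(1) by (auto simp: induced_def hexE_def hends_edge)
      then have "edge q \<in> {e}" unfolding v(3) .
      then have "edge q = edge p" using p(2) by simp
      then have "q \<in> edge p" by (auto simp: edge_def)
      then have "q = p \<otimes> a" using q by (auto simp: edge_def)
      then show False using qG tri_mult_a[OF p(1)] by simp
    qed
    have "\<exists>ys. boundary_cycle (insert (tri p) (S - {v})) ys"
    proof (rule boundary_cycle_insert[OF p(1) _ _ pa _ _ xs])
      show "tri (p \<otimes> c \<otimes> a) \<notin> S - {v}" "tri (p \<otimes> c \<otimes> c \<otimes> a) \<notin> S - {v}"
        using leaf[of "p \<otimes> c"] leaf[of "p \<otimes> c \<otimes> c"] c_distinct[OF p(1)] by (simp_all add: tri_def)
    qed (use fS p in auto)
    moreover have "insert (tri p) (S - {v}) = S" using v p by auto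
    ultimately show ?thesis by simp
  qed
qed

end

subsection \<open>Cycles and paths in the Cayley graph\<close>

text \<open>Such a permutation is a product of \<open>card A div 2\<close> disjoint transpositions;
  the induction strips off one of them.\<close>

lemma sign_fixpoint_free_involution:
  assumes "finite A" "p permutes A" "\<And>x. x \<in> A \<Longrightarrow> p x \<noteq> x" "\<And>x. p (p x) = x"
  shows "sign p = (-1) ^ (card A div 2)"
  using assms
proof (induction "card A" arbitrary: A p rule: less_induct)
  case less
  show ?case
  proof (cases "A = {}")
    case True
    then show ?thesis using less.prems(2) by simp
  next
    case False
    then obtain x where x: "x \<in> A" by auto
    define q where "q = transpose x (p x) \<circ> p"
    have px: "p x \<in> A" "p x \<noteq> x" using x less.prems permutes_in_image by metis+
    have A2: "card A = card (A - {x, p x}) + 2"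
      using card_Diff_subset[of "{x, p x}" A] card_mono[OF less.prems(1), of "{x, p x}"] x px by auto
    have q_eq: "q y = (if y = x \<or> y = p x then y else p y)" for y
      using less.prems(4) unfolding q_def by (metis comp_apply transpose_apply_first transpose_apply_other transpose_apply_second)
    have q: "q permutes A"
      unfolding q_def using x px less.prems(2) by (intro permutes_compose permutes_swap_id)
    have "q permutes (A - {x, p x})"
      by (rule permutes_superset[OF q]) (auto simp: q_eq)
    then have "sign q = (-1) ^ (card (A - {x, p x}) div 2)"
    proof (rule less.hyps[rotated 2])
      show "q (q y) = y" for y using less.prems(4) q_eq by metis
    qed (use A2 less.prems q_eq in auto)
    moreover have "p = transpose x (p x) \<circ> q" by (simp add: q_def fun_eq_iff)
    then have "sign p = sign (transpose x (p x)) * sign q"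
      using permutes_imp_permutation[OF less.prems(1) q]
      by (metis sign_compose permutation_swap_id)
    ultimately show ?thesis using A2 px by (simp add: sign_swap_id)
  qed
qed

text \<open>\<open>L\<close> is the left regular representation, continued by the identity outside
  the carrier as \<open>permutes\<close> demands. Composed with \<open>sign\<close> it is a
  homomorphism to the signs.\<close>

lemma (in group) sign_translation_mult:
  assumes "finite (carrier G)" "g \<in> carrier G" "h \<in> carrier G"
  defines "L \<equiv> \<lambda>g x. if x \<in> carrier G then g \<otimes> x else x"
  shows "L g permutes carrier G" and "sign (L (g \<otimes> h)) = sign (L g) * sign (L h)"
proof -
  have perm: "L k permutes carrier G" if k: "k \<in> carrier G" for k
  proof (rule bij_imp_permutes)
    have "bij_betw (\<lambda>x. k \<otimes> x) (carrier G) (carrier G)"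
      by (rule bij_betw_byWitness[where f' = "\<lambda>x. inv k \<otimes> x"]) (use k in \<open>auto simp: m_assoc[symmetric]\<close>)
    then show "bij_betw (L k) (carrier G) (carrier G)"
      by (rule iffD1[OF bij_betw_cong, rotated]) (auto simp: L_def)
  qed (auto simp: L_def)
  then show "L g permutes carrier G" using assms by auto
  have "L (g \<otimes> h) = L g \<circ> L h" using assms by (auto simp: L_def m_assoc fun_eq_iff)
  then show "sign (L (g \<otimes> h)) = sign (L g) * sign (L h)"
    using sign_compose perm assms permutes_imp_permutation by metis
qed

section \<open>From vertex lists to walks and cycles in the digraph\<close>

lemma path_pairs_zip: "set (zip zs (tl zs)) = path_pairs zs"
  by (induction zs rule: path_pairs.induct) auto

lemma awalk_zip:
  assumes "zs \<noteq> []" "set zs \<subseteq> pverts H" "path_pairs zs \<subseteq> parcs H"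
  shows "pre_digraph.awalk (with_proj H) (hd zs) (zip zs (tl zs)) (last zs)"
    and "pre_digraph.awalk_verts (with_proj H) (hd zs) (zip zs (tl zs)) = zs"
proof -
  have "pre_digraph.cas (with_proj H) (hd zs) (zip zs (tl zs)) (last zs) \<and>
    pre_digraph.awalk_verts (with_proj H) (hd zs) (zip zs (tl zs)) = zs"
    using assms(1)
    by (induction zs rule: path_pairs.induct) (auto simp: pre_digraph.cas.simps pre_digraph.awalk_verts.simps)
  then show "pre_digraph.awalk (with_proj H) (hd zs) (zip zs (tl zs)) (last zs)"
    "pre_digraph.awalk_verts (with_proj H) (hd zs) (zip zs (tl zs)) = zs"
    using assms by (auto simp: pre_digraph.awalk_def path_pairs_zip)
qed

lemma ugraph_cycle_of_list:
  assumes "distinct xs" "length xs \<ge> 3" "set xs \<subseteq> pverts H" "cycle_pairs xs \<subseteq> parcs H"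
  shows "\<exists>p. ugraph_cycle (with_proj H) p \<and> length p = length xs \<and> tail (with_proj H) ` set p = set xs"
proof -
  define zs where "zs = xs @ [hd xs]"
  define p where "p = zip zs (tl zs)"
  have ne: "xs \<noteq> []" using assms(2) by auto
  have z: "zs \<noteq> []" "hd zs = hd xs" "last zs = hd xs" "set zs = set xs" using ne by (auto simp: zs_def)
  have "path_pairs zs = cycle_pairs xs"
    using ne by (simp add: zs_def path_pairs_append cycle_pairs_def)
  then have w: "pre_digraph.awalk (with_proj H) (hd xs) p (hd xs)"
      "pre_digraph.awalk_verts (with_proj H) (hd xs) p = zs"
    using awalk_zip[of zs H] z assms by (auto simp: p_def)
  have lp: "length p = length xs" by (simp add: p_def zs_def)
  have "distinct (tl zs)" using ne assms(1) by (cases xs) (auto simp: zs_def)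
  then have "ugraph_cycle (with_proj H) p"
    using w lp assms(2) by (auto simp: ugraph_cycle_def pre_digraph.cycle_def intro!: exI[of _ "hd xs"])
  moreover have "map fst p = xs"
    by (simp add: p_def zs_def map_fst_zip_take)
  then have "set (map fst p) = set xs" by simp
  then have "tail (with_proj H) ` set p = set xs" by simp
  ultimately show ?thesis using lp by blast
qed

context hexagonal
begin

lemma boundary_cycle_arcs:
  assumes xs: "boundary_cycle S xs" and b: "b = c \<otimes> a"
  shows "cycle_pairs xs \<subseteq> parcs (cayley_graph G {a, b, inv b})"
proof
  fix e assume e: "e \<in> cycle_pairs xs"
  obtain x y where xy: "e = (x, y)" by (cases e)
  have "xs \<noteq> []" using xs by (auto simp: boundary_cycle_def)
  have pp: "(u, v) \<in> path_pairs zs \<Longrightarrow> u \<in> set zs" for u v and zs :: "'a list"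
    by (induction zs rule: path_pairs.induct) auto
  have "x \<in> set xs" using e xy \<open>xs \<noteq> []\<close> pp by (auto simp: cycle_pairs_def)
  then have "x \<in> carrier G" using xs by (auto simp: boundary_cycle_def around_def)
  moreover have "y = x \<otimes> a \<or> y = x \<otimes> b" using xs e xy b unfolding boundary_cycle_def by blast
  ultimately show "e \<in> parcs (cayley_graph G {a, b, inv b})"
    using xy unfolding cayley_graph_def by auto
qed

text \<open>\<open>around S\<close> is closed under right multiplication by \<open>a\<close>, hence
  so is its complement, and the two elements left over form one edge of type
  \<open>a\<close>.\<close>

lemma boundary_cycle_missing_pair:
  assumes xs: "boundary_cycle S xs" and len: "length xs + 2 = card (carrier G)"
  shows "\<exists>x \<in> carrier G. carrier G - set xs = {x, x \<otimes> a} \<and> x \<otimes> a \<noteq> x"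
proof -
  have X: "distinct xs" "set xs = around S" using xs by (auto simp: boundary_cycle_def)
  have "card (set xs) = length xs" using X(1) distinct_card by blast
  moreover have "set xs \<subseteq> carrier G" using X(2) by (auto simp: around_def)
  ultimately have c2: "card (carrier G - set xs) = 2"
    using card_compl[of "set xs"] len by simp
  then have "carrier G - set xs \<noteq> {}" by (metis card.empty zero_neq_numeral)
  then obtain x where x: "x \<in> carrier G" "x \<notin> around S" using X by auto
  then have "x \<otimes> a \<notin> around S" "x \<otimes> a \<in> carrier G" using a by (auto simp: around_def mult_aa)
  then have "{x, x \<otimes> a} \<subseteq> carrier G - set xs" using x X by auto
  moreover have "x \<otimes> a \<noteq> x" by (rule mult_a_neq[OF x(1)])
  moreover from this have "card {x, x \<otimes> a} = 2" by auto
  ultimately have "{x, x \<otimes> a} = carrier G - set xs"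
    using c2 fin by (intro card_subset_eq) auto
  then show ?thesis using x \<open>x \<otimes> a \<noteq> x\<close> by blast
qed

text \<open>Start on the missing edge from \<open>x \<otimes> a\<close> to \<open>x\<close>. The
  neighbour \<open>x \<otimes> b\<close> differs from both, so it lies on the cycle, which is then
  traversed once from there.\<close>

lemma hamilton_path_of_boundary_cycle:
  assumes xs: "boundary_cycle S xs" and len: "length xs + 2 = card (carrier G)"
    and b: "b = c \<otimes> a"
  shows "\<exists>u p v. hamilton_path (with_proj (cayley_graph G {a, b, inv b})) u p v"
proof -
  let ?H = "cayley_graph G {a, b, inv b}"
  have X: "distinct xs" "set xs = around S" "xs \<noteq> []" using xs by (auto simp: boundary_cycle_def)
  obtain x where x: "x \<in> carrier G" "carrier G - set xs = {x, x \<otimes> a}" "x \<otimes> a \<noteq> x"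
    using boundary_cycle_missing_pair[OF xs len] by blast
  have bG: "b \<in> carrier G" using a c b by simp
  have "b \<noteq> a" using a c b by simp
  moreover have "b \<noteq> \<one>"
  proof
    assume "b = \<one>"
    then have "c = a" using a c b by (metis m_assoc l_one r_one)
    then show False using a_not_c by simp
  qed
  ultimately have "x \<otimes> b \<noteq> x \<otimes> a" "x \<otimes> b \<noteq> x" using x a bG by auto
  then have "x \<otimes> b \<in> set xs" using x bG by blast
  then obtain us vs where uv: "xs = us @ (x \<otimes> b) # vs" by (meson split_list)
  define ws where "ws = ((x \<otimes> b) # vs) @ us"
  have cw: "cycle_pairs ws = cycle_pairs xs"
  proof (cases "us = []")
    case False
    then show ?thesis using cycle_pairs_rotate[of "(x \<otimes> b) # vs" us] uv by (simp add: ws_def)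
  qed (simp add: ws_def uv)
  have wp: "hd ws = x \<otimes> b" "ws \<noteq> []" "set ws = set xs" "distinct ws"
    using uv X(1) by (auto simp: ws_def)
  define zs where "zs = [x \<otimes> a, x] @ ws"
  have "path_pairs ws \<subseteq> parcs ?H"
    using boundary_cycle_arcs[OF xs b] unfolding cw[symmetric] by (simp add: cycle_pairs_def)
  moreover have "(x \<otimes> a, x) \<in> parcs ?H"
  proof -
    have "(x \<otimes> a, x) = (x \<otimes> a, (x \<otimes> a) \<otimes> a)" "x \<otimes> a \<in> carrier G" using x a by (auto simp: mult_aa)
    then show ?thesis unfolding cayley_graph_def by auto
  qed
  moreover have "(x, x \<otimes> b) \<in> parcs ?H" using x unfolding cayley_graph_def by auto
  ultimately have pz: "path_pairs zs \<subseteq> parcs ?H"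
    using wp by (simp add: zs_def path_pairs_append[of "[x \<otimes> a, x]" ws, simplified])
  have sz: "set zs = carrier G" using wp x X by (auto simp: zs_def around_def)
  have dz: "distinct zs" using wp x by (auto simp: zs_def)
  have vH: "pverts ?H = carrier G" by (simp add: cayley_graph_def)
  have "zs \<noteq> []" by (simp add: zs_def)
  then have "hamilton_path (with_proj ?H) (hd zs) (zip zs (tl zs)) (last zs)"
    using awalk_zip[of zs ?H] pz sz dz vH
    by (simp add: hamilton_path_def pre_digraph.apath_def)
  then show ?thesis by blast
qed

text \<open>Left multiplication by \<open>a\<close> is an odd permutation, while the one by \<open>c\<close> is even.\<close>

lemma even_order_ca:
  assumes "card (carrier G) mod 4 = 2" and s: "(c \<otimes> a) [^] (s::nat) = \<one>"
  shows "even s"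
proof (rule ccontr)
  assume "odd s"
  define L where "L = (\<lambda>g x. if x \<in> carrier G then g \<otimes> x else x)"
  have mult: "sign (L (g \<otimes> h)) = sign (L g) * sign (L h)" if "g \<in> carrier G" "h \<in> carrier G" for g h
    using sign_translation_mult(2)[OF fin that] by (simp add: L_def)
  have "L \<one> = id" by (auto simp: L_def)
  then have one: "sign (L \<one>) = 1" by simp
  have pow: "sign (L (g [^] n)) = sign (L g) ^ n" if "g \<in> carrier G" for g and n :: nat
    by (induction n) (use that one mult in auto)
  have odd_pow: "sign (L g) = 1" if "g \<in> carrier G" "g [^] n = \<one>" "odd n" for g and n :: nat
  proof -
    have "sign (L g) ^ n = 1" using pow[OF that(1), of n] that one by simp
    then show ?thesis using that(3) by (cases "L g" rule: sign_cases) auto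
  qed
  have "c [^] (3::nat) = \<one>" using c by (simp add: numeral_3_eq_3)
  then have "sign (L c) = 1" using odd_pow[OF c(1), of 3] by simp
  moreover have "sign (L (c \<otimes> a)) = 1" using odd_pow[OF _ s \<open>odd s\<close>] a c by simp
  ultimately have "sign (L a) = 1" using mult[OF c(1) a(1)] by simp
  \<comment> \<open>Translation by \<open>a\<close> has no fixed point, so it consists of $|G|/2$
    transpositions, an odd number.\<close>
  moreover have "sign (L a) = (-1) ^ (card (carrier G) div 2)"
  proof (rule sign_fixpoint_free_involution[OF fin])
    show "L a permutes carrier G" using sign_translation_mult(1)[OF fin a(1) a(1)] by (simp add: L_def)
    show "L a x \<noteq> x" if "x \<in> carrier G" for x using that a by (simp add: L_def)
    show "L a (L a x) = x" for x using a by (simp add: L_def m_assoc[symmetric])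
  qed
  moreover have "odd (card (carrier G) div 2)" using assms(1) by presburger
  ultimately show False by simp
qed

end

text \<open>The elements \<open>a\<close>, \<open>b\<close> and their inverses are products of
  factors \<open>a\<close> and \<open>c\<close>, with
  \<open>inv b = a \<otimes> (c \<otimes> c)\<close>. So \<open>Y\<close> is stable under right
  multiplication by the generated group, which acts transitively.\<close>

lemma (in group) right_closed_eq_carrier:
  assumes gen: "generate G {a, b} = carrier G" and a: "a \<in> carrier G" "a \<otimes> a = \<one>"
    and c: "c \<in> carrier G" "c \<otimes> c \<otimes> c = \<one>" and b: "b = c \<otimes> a"
    and Y: "Y \<subseteq> carrier G" "Y \<noteq> {}" "\<And>x. x \<in> Y \<Longrightarrow> x \<otimes> a \<in> Y" "\<And>x. x \<in> Y \<Longrightarrow> x \<otimes> c \<in> Y"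
  shows "Y = carrier G"
proof -
  have bG: "b \<in> carrier G" using a c b by simp
  have ia: "inv a = a" using a inv_equality by blast
  have "(c \<otimes> c) \<otimes> c = \<one>" using c by simp
  then have "inv c = c \<otimes> c" using c inv_equality by blast
  then have ib: "inv b = a \<otimes> (c \<otimes> c)" using a c b ia by (simp add: inv_mult_group)
  have yb: "y \<otimes> b \<in> Y" if "y \<in> Y" for y
  proof -
    have "y \<otimes> b = y \<otimes> c \<otimes> a" using that Y(1) a c b by (auto simp: m_assoc)
    then show ?thesis using Y(3,4) that by simp
  qed
  have yib: "y \<otimes> inv b \<in> Y" if "y \<in> Y" for y
  proof -
    have "y \<otimes> inv b = y \<otimes> a \<otimes> c \<otimes> c" using that Y(1) a c ib by (auto simp: m_assoc)
    then show ?thesis using Y(3,4) that by simp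
  qed
  have key: "y \<otimes> h \<in> Y" if "h \<in> generate G {a, b}" "y \<in> Y" for h y
    using that
  proof (induction h arbitrary: y rule: generate.induct)
    case one
    then show ?case using Y(1) by auto
  next
    case (incl h)
    then show ?case using Y(3) yb by auto
  next
    case (inv h)
    then show ?case using Y(3) yib ia by auto
  next
    case (eng h1 h2)
    have "h1 \<in> carrier G" "h2 \<in> carrier G" using eng.hyps gen by auto
    then have "y \<otimes> (h1 \<otimes> h2) = y \<otimes> h1 \<otimes> h2" using eng.prems Y(1) by (auto simp: m_assoc)
    then show ?case using eng by simp
  qed
  obtain y where y: "y \<in> Y" using Y(2) by auto
  have "x \<in> Y" if "x \<in> carrier G" for x
  proof -
    have yG: "y \<in> carrier G" using y Y(1) by auto
    then have "y \<otimes> (inv y \<otimes> x) \<in> Y" using key[OF _ y, of "inv y \<otimes> x"] gen that by simp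
    then show ?thesis using yG that by (simp add: m_assoc[symmetric])
  qed
  then show ?thesis using Y(1) by auto
qed

theorem theorem1p1:
  fixes G :: "('a, 'm) monoid_scheme" (structure)
    and a b :: 'a and s :: nat
  defines "X \<equiv> with_proj (cayley_graph G {a, b, inv b})"
  assumes "s \<ge> 3"
    and "group G" and "finite (carrier G)"
    and "a \<in> carrier G" and "b \<in> carrier G"
    and "generate G {a, b} = carrier G"
    and "group.ord G a = 2" and "group.ord G b = s" and "group.ord G (a \<otimes> b) = 3"
  shows "(order G mod 4 = 2 \<longrightarrow> s mod 4 = 2 \<and> (\<exists>p. hamilton_cycle X p)) \<and>
         (order G mod 4 = 0 \<longrightarrow>
            (\<exists>p. ugraph_cycle X p \<and> length p = order G - 2) \<and>
            (\<exists>u p v. hamilton_path X u p v))"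
proof -
  interpret group G by fact
  note aG = \<open>a \<in> carrier G\<close> and bG = \<open>b \<in> carrier G\<close>
  \<comment> \<open>The conjugate of \<open>a \<otimes> b\<close> by \<open>a\<close>, hence again
    of order 3, and \<open>b = c \<otimes> a\<close>.\<close>
  define c where "c = b \<otimes> a"
  have cG: "c \<in> carrier G" using aG bG by (simp add: c_def)
  have "a [^] (2::nat) = \<one>" using aG pow_ord_eq_1 assms(8) by metis
  then have aa: "a \<otimes> a = \<one>" using aG by (simp add: numeral_2_eq_2)
  have a1: "a \<noteq> \<one>" using assms(8) ord_id by auto
  have ca: "c \<otimes> a = b" using aG bG aa by (simp add: c_def m_assoc)
  have "(a \<otimes> b) [^] (3::nat) = \<one>" using aG bG pow_ord_eq_1 assms(10) by (metis m_closed)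
  then have ab3: "a \<otimes> b \<otimes> (a \<otimes> b) \<otimes> (a \<otimes> b) = \<one>" using aG bG by (simp add: numeral_3_eq_3)
  have ccc: "c \<otimes> c \<otimes> c = \<one>"
  proof -
    have "c \<otimes> c \<otimes> c = a \<otimes> (a \<otimes> b \<otimes> (a \<otimes> b) \<otimes> (a \<otimes> b)) \<otimes> a"
      using aG bG aa by (simp add: c_def m_assoc[symmetric])
    then show ?thesis using ab3 aG aa by simp
  qed
  have c1: "c \<noteq> \<one>"
  proof
    assume "c = \<one>"
    then have "b = a" using ca aG by simp
    then show False using assms(2,8,9) by simp
  qed
  interpret hexagonal G a c
  proof
    show "Y = carrier G" if "Y \<subseteq> carrier G" "Y \<noteq> {}" "\<And>x. x \<in> Y \<Longrightarrow> x \<otimes> a \<in> Y"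
      "\<And>x. x \<in> Y \<Longrightarrow> x \<otimes> c \<in> Y" for Y
      by (rule right_closed_eq_carrier[OF assms(7) aG aa cG ccc ca[symmetric] that])
  qed (use assms aG cG a1 aa c1 ccc in auto)
  interpret cyclically_connected_cubic hends hexE hexV by (rule hex_cyclically_connected)
  let ?H = "cayley_graph G {a, b, inv b}"
  have n: "order G = 3 * card hexV" using card_carrier by (simp add: order_def)
  \<comment> \<open>3 is its own inverse modulo 4, so \<open>order G = 3 * card hexV\<close> can be
    solved for \<open>card hexV\<close>.\<close>
  have hex_mod_4: "card hexV mod 4 = 3 * (order G mod 4) mod 4"
  proof -
    have "3 * (order G mod 4) mod 4 = 3 * order G mod 4" by (rule mod_mult_right_eq)
    also have "3 * order G = card hexV + 2 * card hexV * 4" using n by simp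
    also have "\<dots> mod 4 = card hexV mod 4" by (rule mod_mult_self1)
    finally show ?thesis by simp
  qed
  have vs: "pverts ?H = carrier G" by (simp add: cayley_graph_def)
  have sub: "set xs \<subseteq> carrier G" if "boundary_cycle S xs" for S xs
    using that by (auto simp: boundary_cycle_def around_def)
  have dist: "distinct xs" "length xs = 4 * card S + 2" if "boundary_cycle S xs" for S xs
    using that by (auto simp: boundary_cycle_def)
  show ?thesis
  proof (intro conjI impI)
    assume m: "order G mod 4 = 2"
    have "even s"
      by (rule even_order_ca) (use m ca bG pow_ord_eq_1[OF bG] assms(9) in \<open>auto simp: order_def\<close>)
    moreover have "s dvd order G" using ord_dvd_group_order[OF bG] assms(9) by simp
    then have "\<not> 4 dvd s" using m by (metis dvd_trans dvd_imp_mod_0 zero_neq_numeral)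
    ultimately show "s mod 4 = 2" by presburger
    have hexm: "card hexV mod 4 = 2" using m hex_mod_4 by simp
    obtain S where S: "S \<subseteq> hexV" "S \<noteq> {}" "sparse hends (induced hends hexE S) S"
        "card (induced hends hexE S) + 1 = card S" "4 * card S + 2 = 3 * card hexV"
      using induced_tree_2_mod_4[OF hexm] by blast
    then obtain xs where xs: "boundary_cycle S xs" using boundary_cycle_tree by blast
    have "length xs = card (carrier G)" using dist(2)[OF xs] S(5) card_carrier by simp
    then have full: "set xs = carrier G"
      using sub[OF xs] dist(1)[OF xs] fin by (intro card_subset_eq) (auto simp: distinct_card)
    have "card S > 0" using S(4) by linarith
    then have "length xs \<ge> 3" using dist(2)[OF xs] by simp
    then obtain p where "ugraph_cycle (with_proj ?H) p" "tail (with_proj ?H) ` set p = set xs"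
      using ugraph_cycle_of_list[OF dist(1)[OF xs], of ?H] sub[OF xs] vs boundary_cycle_arcs[OF xs ca[symmetric]] by auto
    then show "\<exists>p. hamilton_cycle X p" using full vs by (auto simp: hamilton_cycle_def X_def)
  next
    assume m: "order G mod 4 = 0"
    have hexm: "card hexV mod 4 = 0" using m hex_mod_4 by simp
    obtain S where S: "S \<subseteq> hexV" "S \<noteq> {}" "sparse hends (induced hends hexE S) S"
        "card (induced hends hexE S) + 1 = card S" "4 * card S + 4 = 3 * card hexV"
      using induced_tree_0_mod_4[OF hexm] by blast
    then obtain xs where xs: "boundary_cycle S xs" using boundary_cycle_tree by blast
    have len: "length xs + 2 = card (carrier G)" using dist(2)[OF xs] S(5) card_carrier by simp
    have "card S > 0" using S(4) by linarith
    then have "length xs \<ge> 3" using dist(2)[OF xs] by simp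
    then obtain p where "ugraph_cycle (with_proj ?H) p" "length p = length xs"
      using ugraph_cycle_of_list[OF dist(1)[OF xs], of ?H] sub[OF xs] vs boundary_cycle_arcs[OF xs ca[symmetric]] by auto
    then show "\<exists>p. ugraph_cycle X p \<and> length p = order G - 2"
      using len by (auto simp: X_def order_def intro!: exI[of _ p])
    show "\<exists>u p v. hamilton_path X u p v"
      unfolding X_def by (rule hamilton_path_of_boundary_cycle[OF xs len ca[symmetric]])
  qed
qed

end
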